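(* (1) Let $R$ be a ring and assume $\preccurlyeq\,\in\mathscr{L}^1_R$ is pleasant. Then $(R\text{-}\mathrm{Mod},\preccurlyeq)$ has the amalgamation property. (2) Assume $\preccurlyeq\,\in\mathscr{L}^2_{\mathbb Z}$ is positive syntactic and lies above $\leq^{\mathrm{weak}}_{\mathrm{pp},\infty}$ in $\mathscr{L}_{\mathbb Z}$ (that is, $\preccurlyeq\,\subseteq\,\leq^{\mathrm{weak}}_{\mathrm{pp},\infty}$). Then $(\mathbb Z\text{-}\mathrm{Mod},\preccurlyeq)$ does not have the amalgamation property.
   Context: Rings are associative with identity, modules are left modules. $R\text{-}\mathrm{Mod}$ is the class of all $R$-modules, viewed as structures in the language $\tau_R=\{0,+,-\}\cup\{r\cdot\mid r\in R\}$. $A\leq B$ means submodule, $A\leq_\oplus B$ means direct summand. AEC: a pair $\mathcal K=(\mathbf K,\preccurlyeq)$, with $\mathbf K$ a class of $L$-structures and $\preccurlyeq$ a binary relation on $\mathbf K$, such that: (i) $\mathbf K$ and $\preccurlyeq$ are closed under isomorphisms; (ii) $A\preccurlyeq B$ implies $A$ is a substructure of $B$; (iii) $\preccurlyeq$ is a partial order; (iv) if $(A_i)_{i<\delta}$ ($\delta$ limit) is an increasing continuous $\preccurlyeq$-chain in $\mathbf K$, then $A=\bigcup_{i<\delta}A_i\in\mathbf K$, $A_j\preccurlyeq A$ for all $j<\delta$, and if $A_i\preccurlyeq B$ for all $i<\delta$ then $A\preccurlyeq B$; (v) if $A\preccurlyeq C$, $B\preccurlyeq C$ and $A$ is a substructure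 of $B$ then $A\preccurlyeq B$; (vi) there is a cardinal $\lambda\geq|L|+\aleph_0$ such that for all $B\in\mathbf K$, $X\subseteq B$ there is $A\in\mathbf K$ with $X\subseteq A\preccurlyeq B$ and $|A|\leq|X|+\lambda$. An embedding $f:A\to B$ is strong if $f(A)\preccurlyeq B$. $\mathcal K$ has the amalgamation property if every span $A\preccurlyeq B$, $A\preccurlyeq C$ in $\mathcal K$ can be completed to a commutative square of strong embeddings (i.e. there are $D\in\mathbf K$ and strong embeddings $f:B\to D$, $g:C\to D$ with $f\restriction A=g\restriction A$). $\mathscr{L}_R$ is the class of all binary relations $\preccurlyeq$ on $R\text{-}\mathrm{Mod}$ such that $(R\text{-}\mathrm{Mod},\preccurlyeq)$ is an AEC and $A\leq_\oplus B$ implies $A\preccurlyeq B$, ordered by reverse inclusion. Purity: $A\leq_{\mathrm{pp}}B$ iff $A\leq B$ and every finite system of $R$-linear equations with right-hand side in $A$ solvable in $B$ is solvable in $A$. $\mathscr{L}^1_R=\{\preccurlyeq\,\in\mathscr L_R\mid\ \leq_{\mathrm{pp}}\subseteq\preccurlyeq\}$ and $\mathscr{L}^2_R=\{\preccurlyeq\,\in\mathscr L_R\mid\ \preccurlyeq\,\subseteq\,\leq_{\mathrm{pp}}\}$. For a collection (set or class) $\Sigma$ of formulas in $\tau_R$, $A\leq_\Sigma B$ iff $A\leq B$ and for all $\varphi(\bar x)\in\Sigma$, $\bar a\in A^{|\bar x|}$: $A\models\varphi(\bar a)\Leftrightarrow B\models\varphi(\bar a)$. Pleasant: a set $\Sigma$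 of formulas is pleasant if every member has the form $\exists\bar y\,(H\bar y=K\bar x)$ with $H\in\operatorname{Mat}_{m\times n}(R)$, $K\in\operatorname{Mat}_{m\times s}(R)$, $\bar y=(y_1,\dots,y_n)$, $\bar x=(x_1,\dots,x_s)$, and whenever $\exists\bar y\,(H\bar y=K\bar x)\in\Sigma$ then also $\exists\bar y\,(H\bar y=\bar z)\in\Sigma$ with $\bar z=(z_1,\dots,z_m)$. A relation $\preccurlyeq$ is pleasant if $\preccurlyeq\,=\,\leq_\Sigma$ for some pleasant $\Sigma$. Infinitary pp-formulas: for infinite cardinals $\lambda\leq\kappa$, ordinals $\epsilon<\lambda$ and ordinals $\alpha$, the set $\Lambda^{\kappa,\lambda}_{\alpha,\epsilon}$ of formulas in free variables $\bar x$, $|\bar x|=\epsilon$, is defined by induction on $\alpha$: $\Lambda^{\kappa,\lambda}_{0,\epsilon}$ is the set of equations $\sum_{\zeta<\epsilon}r_\zeta x_\zeta=0$ with $r_\zeta\in R$, finitely many nonzero; for $\alpha$ limit, $\Lambda^{\kappa,\lambda}_{\alpha,\epsilon}=\bigcup_{\beta<\alpha}\Lambda^{\kappa,\lambda}_{\beta,\epsilon}$; $\Lambda^{\kappa,\lambda}_{\beta+1,\epsilon}$ is the set of formulas $\exists\bar y\bigwedge\Psi$ with $|\bar y|=\zeta<\lambda$ ($\zeta=0$ allowed) and $\Psi\subseteq\Lambda^{\kappa,\lambda}_{\beta,\epsilon+\zeta}$, $|\Psi|<\kappa$. $\Lambda^{\infty,\infty}_\infty$ is the union of all $\Lambda^{\kappa,\lambda}_{\alpha,\epsilon}$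 over all $\kappa,\lambda,\alpha,\epsilon$. A relation $\preccurlyeq$ is positive syntactic if $\preccurlyeq\,=\,\leq_\Sigma$ for some $\Sigma\subseteq\Lambda^{\infty,\infty}_\infty$. A first-order pp-formula is a first-order formula equivalent, over $R$-modules, to one of the form $\exists\bar y\,(H\bar y=K\bar x)$ with $H,K$ finite matrices over $R$. A weak infinitary pp-formula is a formula $\exists\bar y\bigwedge_{i<\kappa}\psi_i(\bar x,\bar y)$ with $\bar x,\bar y$ finite tuples, $\kappa$ a cardinal, each $\psi_i$ a first-order pp-formula; $\Lambda^{\mathrm{wpp}}_\infty$ is the collection of all of them. $A\leq^{\mathrm{weak}}_{\mathrm{pp},\infty}B$ iff $A\leq_{\Lambda^{\mathrm{wpp}}_\infty}B$. *)

theory Defs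
  imports "HOL-Library.Equipollence" "HOL-Algebra.IntRing"
begin

section \<open>The universe of discourse\<close>

text \<open>
  HOL has no type of all sets, so \<open>R\<close>-Mod is taken relative to a universe: a type \<open>'u\<close> of
  inaccessible cardinality.  ``Sets'' are the subsets of \<open>'u\<close> of cardinality less than that of
  \<open>'u\<close> (here called small), classes are arbitrary subsets of the types below.  Up to bijection
  this is the cumulative hierarchy up to the inaccessible cardinal, together with all its subclasses.
\<close>

definition inaccessible :: "'u set \<Rightarrow> bool" where
  "inaccessible S \<longleftrightarrow>
     (UNIV :: nat set) \<prec> S \<and>
     (\<forall>X. X \<subseteq> S \<and> X \<prec> S \<longrightarrow> Pow X \<prec> S) \<and>
     (\<forall>I F. I \<subseteq> S \<and> I \<prec> S \<and> (\<forall>i\<in>I. F i \<subseteq> S \<and> F i \<prec> S) \<longrightarrow> (\<Union>i\<in>I. F i) \<prec> S)"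

definition small :: "'u set \<Rightarrow> bool" where
  "small X \<longleftrightarrow> X \<prec> (UNIV :: 'u set)"

text \<open>
  Ordinals (of the universe) are the elements of \<open>'u\<close>, compared by the cardinal well-order
  \<open>card_of UNIV\<close>: in it every element has small initial segment, and every small ordinal is the
  type of exactly one initial segment \<open>seg \<alpha>\<close>.  Cardinals are represented by small sets, compared
  by \<open>\<lesssim>\<close> and \<open>\<prec>\<close>; an ordinal \<open>\<alpha>\<close> is less than the infinite cardinal \<open>L\<close> iff \<open>seg \<alpha> \<prec> L\<close>.
\<close>

definition ord_less :: "'u \<Rightarrow> 'u \<Rightarrow> bool" where
  "ord_less \<alpha> \<beta> \<longleftrightarrow> (\<alpha>, \<beta>) \<in> card_of (UNIV :: 'u set) \<and> \<alpha> \<noteq> \<beta>"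

definition seg :: "'u \<Rightarrow> 'u set" where
  "seg \<alpha> = {\<beta>. ord_less \<beta> \<alpha>}"

definition ord_zero :: "'u \<Rightarrow> bool" where
  "ord_zero \<alpha> \<longleftrightarrow> seg \<alpha> = {}"

definition ord_succ :: "'u \<Rightarrow> 'u \<Rightarrow> bool" where
  "ord_succ \<beta> \<alpha> \<longleftrightarrow> ord_less \<beta> \<alpha> \<and> \<not> (\<exists>\<gamma>. ord_less \<beta> \<gamma> \<and> ord_less \<gamma> \<alpha>)"

definition ord_limit :: "'u \<Rightarrow> bool" where
  "ord_limit \<alpha> \<longleftrightarrow> \<not> ord_zero \<alpha> \<and> \<not> (\<exists>\<beta>. ord_succ \<beta> \<alpha>)"

section \<open>Structures in the language of modules\<close>

text \<open>
  The library's modules are over commutative rings only; here \<open>R\<close> is an arbitrary ring with identity.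
  The operations are required to be undefined off the universe (and off \<open>R\<close>), so that equality of
  records is equality of structures.
\<close>

record ('r, 'u) struct =
  univ :: "'u set"
  zeroM :: 'u
  addM :: "'u \<Rightarrow> 'u \<Rightarrow> 'u"
  negM :: "'u \<Rightarrow> 'u"
  scalM :: "'r \<Rightarrow> 'u \<Rightarrow> 'u"

definition tau_structure :: "'r ring \<Rightarrow> ('r, 'u) struct \<Rightarrow> bool" where
  "tau_structure R M \<longleftrightarrow>
     zeroM M \<in> univ M \<and>
     (\<forall>x\<in>univ M. \<forall>y\<in>univ M. addM M x y \<in> univ M) \<and>
     (\<forall>x\<in>univ M. negM M x \<in> univ M) \<and>
     (\<forall>r\<in>carrier R. \<forall>x\<in>univ M. scalM M r x \<in> univ M) \<and>
     (\<forall>x y. x \<notin> univ M \<or> y \<notin> univ M \<longrightarrow> addM M x y = undefined) \<and>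
     (\<forall>x. x \<notin> univ M \<longrightarrow> negM M x = undefined) \<and>
     (\<forall>r x. r \<notin> carrier R \<or> x \<notin> univ M \<longrightarrow> scalM M r x = undefined)"

definition substructure :: "'r ring \<Rightarrow> ('r, 'u) struct \<Rightarrow> ('r, 'u) struct \<Rightarrow> bool" where
  "substructure R A B \<longleftrightarrow>
     tau_structure R A \<and> tau_structure R B \<and> univ A \<subseteq> univ B \<and> zeroM A = zeroM B \<and>
     (\<forall>x\<in>univ A. \<forall>y\<in>univ A. addM A x y = addM B x y) \<and>
     (\<forall>x\<in>univ A. negM A x = negM B x) \<and>
     (\<forall>r\<in>carrier R. \<forall>x\<in>univ A. scalM A r x = scalM B r x)"

definition iso_struct ::
  "'r ring \<Rightarrow> ('u \<Rightarrow> 'u) \<Rightarrow> ('r, 'u) struct \<Rightarrow> ('r, 'u) struct \<Rightarrow> bool" where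
  "iso_struct R f A B \<longleftrightarrow>
     tau_structure R A \<and> tau_structure R B \<and> bij_betw f (univ A) (univ B) \<and>
     f (zeroM A) = zeroM B \<and>
     (\<forall>x\<in>univ A. \<forall>y\<in>univ A. f (addM A x y) = addM B (f x) (f y)) \<and>
     (\<forall>x\<in>univ A. f (negM A x) = negM B (f x)) \<and>
     (\<forall>r\<in>carrier R. \<forall>x\<in>univ A. f (scalM A r x) = scalM B r (f x))"

abbreviation add_group :: "('r, 'u) struct \<Rightarrow> 'u monoid" where
  "add_group M \<equiv> \<lparr>carrier = univ M, mult = addM M, one = zeroM M\<rparr>"

definition left_module :: "'r ring \<Rightarrow> ('r, 'u) struct \<Rightarrow> bool" where
  "left_module R M \<longleftrightarrow>
     tau_structure R M \<and> comm_group (add_group M) \<and>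
     (\<forall>x\<in>univ M. negM M x = inv\<^bsub>add_group M\<^esub> x) \<and>
     (\<forall>r\<in>carrier R. \<forall>x\<in>univ M. \<forall>y\<in>univ M.
        scalM M r (addM M x y) = addM M (scalM M r x) (scalM M r y)) \<and>
     (\<forall>r\<in>carrier R. \<forall>s\<in>carrier R. \<forall>x\<in>univ M.
        scalM M (r \<oplus>\<^bsub>R\<^esub> s) x = addM M (scalM M r x) (scalM M s x)) \<and>
     (\<forall>r\<in>carrier R. \<forall>s\<in>carrier R. \<forall>x\<in>univ M.
        scalM M (r \<otimes>\<^bsub>R\<^esub> s) x = scalM M r (scalM M s x)) \<and>
     (\<forall>x\<in>univ M. scalM M \<one>\<^bsub>R\<^esub> x = x)"

definition R_Mod :: "'r ring \<Rightarrow> ('r, 'u) struct set" where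
  "R_Mod R = {M. left_module R M \<and> small (univ M)}"

definition submodule_le :: "'r ring \<Rightarrow> ('r, 'u) struct \<Rightarrow> ('r, 'u) struct \<Rightarrow> bool" where
  "submodule_le R A B \<longleftrightarrow> A \<in> R_Mod R \<and> B \<in> R_Mod R \<and> substructure R A B"

definition summand_le :: "'r ring \<Rightarrow> ('r, 'u) struct \<Rightarrow> ('r, 'u) struct \<Rightarrow> bool" where
  "summand_le R A B \<longleftrightarrow>
     submodule_le R A B \<and>
     (\<exists>C. submodule_le R C B \<and> univ A \<inter> univ C = {zeroM B} \<and>
          (\<forall>b\<in>univ B. \<exists>a\<in>univ A. \<exists>c\<in>univ C. b = addM B a c))"

text \<open>
  The system has the \<open>m \<times> n\<close> coefficient matrix \<open>H\<close> and right-hand side \<open>a\<close>;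
  \<open>finprod\<close> in \<open>add_group\<close> is the finite sum.
\<close>

definition solvable_system ::
  "('r, 'u) struct \<Rightarrow> nat \<Rightarrow> nat \<Rightarrow> (nat \<Rightarrow> nat \<Rightarrow> 'r) \<Rightarrow> (nat \<Rightarrow> 'u) \<Rightarrow> bool" where
  "solvable_system M m n H a \<longleftrightarrow>
     (\<exists>b. (\<forall>j<n. b j \<in> univ M) \<and>
          (\<forall>i<m. finprod (add_group M) (\<lambda>j. scalM M (H i j) (b j)) {..<n} = a i))"

definition pp_le :: "'r ring \<Rightarrow> ('r, 'u) struct \<Rightarrow> ('r, 'u) struct \<Rightarrow> bool" where
  "pp_le R A B \<longleftrightarrow>
     submodule_le R A B \<and>
     (\<forall>m n H a. (\<forall>i<m. \<forall>j<n. H i j \<in> carrier R) \<and> (\<forall>i<m. a i \<in> univ A) \<and>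
                solvable_system B m n H a \<longrightarrow> solvable_system A m n H a)"

section \<open>Abstract elementary classes\<close>

text \<open>
  \<open>U\<close> is the union of the family \<open>(A\<^sub>i)\<close>, \<open>i \<in> I\<close>.  For a nonempty chain of substructures
  such a \<open>U\<close> exists, and it is unique because operations are undefined off the universe.
\<close>

definition is_union ::
  "'r ring \<Rightarrow> 'u set \<Rightarrow> ('u \<Rightarrow> ('r, 'u) struct) \<Rightarrow> ('r, 'u) struct \<Rightarrow> bool" where
  "is_union R I A U \<longleftrightarrow> univ U = (\<Union>i\<in>I. univ (A i)) \<and> (\<forall>i\<in>I. substructure R (A i) U)"

definition continuous_chain ::
  "'r ring \<Rightarrow> (('r, 'u) struct \<Rightarrow> ('r, 'u) struct \<Rightarrow> bool) \<Rightarrow> 'u \<Rightarrow>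
   ('u \<Rightarrow> ('r, 'u) struct) \<Rightarrow> bool" where
  "continuous_chain R prec \<delta> A \<longleftrightarrow>
     (\<forall>i\<in>seg \<delta>. \<forall>j\<in>seg \<delta>. ord_less i j \<longrightarrow> prec (A i) (A j)) \<and>
     (\<forall>i\<in>seg \<delta>. ord_limit i \<longrightarrow> is_union R (seg i) A (A i))"

text \<open>
  In the Loewenheim-Skolem clause the cardinal \<open>\<lambda>\<close> is the small infinite set \<open>L\<close>; for infinite
  \<open>\<lambda>\<close> the condition \<open>\<lambda> \<ge> |\<tau>\<^sub>R| + \<aleph>\<^sub>0\<close> says just \<open>\<lambda> \<ge> |R|\<close>, and \<open>X <+> L\<close> has
  cardinality \<open>|X| + \<lambda>\<close>.
\<close>

definition AEC ::
  "'r ring \<Rightarrow> ('r, 'u) struct set \<Rightarrow> (('r, 'u) struct \<Rightarrow> ('r, 'u) struct \<Rightarrow> bool) \<Rightarrow> bool" where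
  "AEC R K prec \<longleftrightarrow>
     (\<forall>A\<in>K. tau_structure R A \<and> small (univ A)) \<and>
     (\<forall>A B. prec A B \<longrightarrow> A \<in> K \<and> B \<in> K) \<and>
     \<comment> \<open>closure under isomorphisms\<close>
     (\<forall>A B f. A \<in> K \<and> iso_struct R f A B \<longrightarrow> B \<in> K) \<and>
     (\<forall>A B A' B' f. prec A B \<and> iso_struct R f B B' \<and> iso_struct R f A A' \<longrightarrow> prec A' B') \<and>
     \<comment> \<open>strong substructures are substructures\<close>
     (\<forall>A B. prec A B \<longrightarrow> substructure R A B) \<and>
     \<comment> \<open>partial order\<close>
     (\<forall>A\<in>K. prec A A) \<and>
     (\<forall>A B. prec A B \<and> prec B A \<longrightarrow> A = B) \<and>
     (\<forall>A B C. prec A B \<and> prec B C \<longrightarrow> prec A C) \<and>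
     \<comment> \<open>unions of continuous chains\<close>
     (\<forall>\<delta> A U. ord_limit \<delta> \<and> (\<forall>i\<in>seg \<delta>. A i \<in> K) \<and> continuous_chain R prec \<delta> A \<and>
              is_union R (seg \<delta>) A U \<longrightarrow>
        U \<in> K \<and> (\<forall>j\<in>seg \<delta>. prec (A j) U) \<and>
        (\<forall>B\<in>K. (\<forall>i\<in>seg \<delta>. prec (A i) B) \<longrightarrow> prec U B)) \<and>
     \<comment> \<open>coherence\<close>
     (\<forall>A B C. prec A C \<and> prec B C \<and> substructure R A B \<longrightarrow> prec A B) \<and>
     \<comment> \<open>Loewenheim-Skolem\<close>
     (\<exists>L :: 'u set. small L \<and> infinite L \<and> carrier R \<lesssim> L \<and>
        (\<forall>B\<in>K. \<forall>X. X \<subseteq> univ B \<longrightarrow>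
           (\<exists>A\<in>K. X \<subseteq> univ A \<and> prec A B \<and> univ A \<lesssim> X <+> L)))"

text \<open>In the next definition \<open>E\<close> is the image \<open>f(A)\<close> as a structure.\<close>

definition strong_embedding ::
  "'r ring \<Rightarrow> (('r, 'u) struct \<Rightarrow> ('r, 'u) struct \<Rightarrow> bool) \<Rightarrow> ('u \<Rightarrow> 'u) \<Rightarrow>
   ('r, 'u) struct \<Rightarrow> ('r, 'u) struct \<Rightarrow> bool" where
  "strong_embedding R prec f A B \<longleftrightarrow>
     (\<exists>E. iso_struct R f A E \<and> substructure R E B \<and> prec E B)"

definition amalgamation_property ::
  "'r ring \<Rightarrow> ('r, 'u) struct set \<Rightarrow> (('r, 'u) struct \<Rightarrow> ('r, 'u) struct \<Rightarrow> bool) \<Rightarrow> bool" where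
  "amalgamation_property R K prec \<longleftrightarrow>
     (\<forall>A\<in>K. \<forall>B\<in>K. \<forall>C\<in>K. prec A B \<and> prec A C \<longrightarrow>
        (\<exists>D\<in>K. \<exists>f g. strong_embedding R prec f B D \<and> strong_embedding R prec g C D \<and>
                     (\<forall>x\<in>univ A. f x = g x)))"

definition L_class :: "'r ring \<Rightarrow> (('r, 'u) struct \<Rightarrow> ('r, 'u) struct \<Rightarrow> bool) set" where
  "L_class R = {prec. AEC R (R_Mod R) prec \<and> (\<forall>A B. summand_le R A B \<longrightarrow> prec A B)}"

definition L1_class :: "'r ring \<Rightarrow> (('r, 'u) struct \<Rightarrow> ('r, 'u) struct \<Rightarrow> bool) set" where
  "L1_class R = {prec \<in> L_class R. \<forall>A B. pp_le R A B \<longrightarrow> prec A B}"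

definition L2_class :: "'r ring \<Rightarrow> (('r, 'u) struct \<Rightarrow> ('r, 'u) struct \<Rightarrow> bool) set" where
  "L2_class R = {prec \<in> L_class R. \<forall>A B. prec A B \<longrightarrow> pp_le R A B}"

section \<open>Formulas\<close>

text \<open>
  Infinitary formulas of \<open>\<tau>\<^sub>R\<close>.  Variables are the elements of \<open>'u\<close>; \<open>BigAnd I \<Phi>\<close> is the
  conjunction of the \<open>\<Phi> i\<close> with \<open>i \<in> I\<close> (values of \<open>\<Phi>\<close> off \<open>I\<close> are irrelevant), and
  \<open>Ex Y \<phi>\<close> quantifies simultaneously over all variables in \<open>Y\<close>.
\<close>

datatype ('r, 'u) trm =
    TVar 'u
  | TZero
  | TAdd "('r, 'u) trm" "('r, 'u) trm"
  | TNeg "('r, 'u) trm"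
  | TScal 'r "('r, 'u) trm"

datatype ('r, 'u) fm =
    Eq "('r, 'u) trm" "('r, 'u) trm"
  | Neg "('r, 'u) fm"
  | And "('r, 'u) fm" "('r, 'u) fm"
  | BigAnd "'u set" "'u \<Rightarrow> ('r, 'u) fm"
  | Ex "'u set" "('r, 'u) fm"

primrec trm_val :: "('r, 'u) struct \<Rightarrow> ('u \<Rightarrow> 'u) \<Rightarrow> ('r, 'u) trm \<Rightarrow> 'u" where
  "trm_val M a (TVar v) = a v"
| "trm_val M a TZero = zeroM M"
| "trm_val M a (TAdd s t) = addM M (trm_val M a s) (trm_val M a t)"
| "trm_val M a (TNeg t) = negM M (trm_val M a t)"
| "trm_val M a (TScal r t) = scalM M r (trm_val M a t)"

primrec sat :: "('r, 'u) fm \<Rightarrow> ('r, 'u) struct \<Rightarrow> ('u \<Rightarrow> 'u) \<Rightarrow> bool" where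
  "sat (Eq s t) M a \<longleftrightarrow> trm_val M a s = trm_val M a t"
| "sat (Neg \<phi>) M a \<longleftrightarrow> \<not> sat \<phi> M a"
| "sat (And \<phi> \<psi>) M a \<longleftrightarrow> sat \<phi> M a \<and> sat \<psi> M a"
| "sat (BigAnd I \<Phi>) M a \<longleftrightarrow> (\<forall>i\<in>I. sat (\<Phi> i) M a)"
| "sat (Ex Y \<phi>) M a \<longleftrightarrow> (\<exists>b. (\<forall>y\<in>Y. b y \<in> univ M) \<and> sat \<phi> M (override_on a b Y))"

primrec trm_vars :: "('r, 'u) trm \<Rightarrow> 'u set" where
  "trm_vars (TVar v) = {v}"
| "trm_vars TZero = {}"
| "trm_vars (TAdd s t) = trm_vars s \<union> trm_vars t"
| "trm_vars (TNeg t) = trm_vars t"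
| "trm_vars (TScal r t) = trm_vars t"

primrec free_vars :: "('r, 'u) fm \<Rightarrow> 'u set" where
  "free_vars (Eq s t) = trm_vars s \<union> trm_vars t"
| "free_vars (Neg \<phi>) = free_vars \<phi>"
| "free_vars (And \<phi> \<psi>) = free_vars \<phi> \<union> free_vars \<psi>"
| "free_vars (BigAnd I \<Phi>) = (\<Union>i\<in>I. free_vars (\<Phi> i))"
| "free_vars (Ex Y \<phi>) = free_vars \<phi> - Y"

primrec trm_over :: "'r ring \<Rightarrow> ('r, 'u) trm \<Rightarrow> bool" where
  "trm_over R (TVar v) \<longleftrightarrow> True"
| "trm_over R TZero \<longleftrightarrow> True"
| "trm_over R (TAdd s t) \<longleftrightarrow> trm_over R s \<and> trm_over R t"
| "trm_over R (TNeg t) \<longleftrightarrow> trm_over R t"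
| "trm_over R (TScal r t) \<longleftrightarrow> r \<in> carrier R \<and> trm_over R t"

primrec first_order :: "'r ring \<Rightarrow> ('r, 'u) fm \<Rightarrow> bool" where
  "first_order R (Eq s t) \<longleftrightarrow> trm_over R s \<and> trm_over R t"
| "first_order R (Neg \<phi>) \<longleftrightarrow> first_order R \<phi>"
| "first_order R (And \<phi> \<psi>) \<longleftrightarrow> first_order R \<phi> \<and> first_order R \<psi>"
| "first_order R (BigAnd I \<Phi>) \<longleftrightarrow> False"
| "first_order R (Ex Y \<phi>) \<longleftrightarrow> finite Y \<and> first_order R \<phi>"

text \<open>
  Total assignments \<open>a\<close> stand for tuples in \<open>A\<close>: only the values at free variables matter, and
  universes are nonempty.
\<close>

definition formula_le ::
  "'r ring \<Rightarrow> ('r, 'u) fm set \<Rightarrow> ('r, 'u) struct \<Rightarrow> ('r, 'u) struct \<Rightarrow> bool" where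
  "formula_le R \<Sigma> A B \<longleftrightarrow>
     submodule_le R A B \<and>
     (\<forall>\<phi>\<in>\<Sigma>. \<forall>a. range a \<subseteq> univ A \<longrightarrow> sat \<phi> A a = sat \<phi> B a)"

text \<open>The term \<open>\<Sum> r\<^sub>i v\<^sub>i\<close> for a list of pairs \<open>(r\<^sub>i, v\<^sub>i)\<close>.\<close>

primrec lin_comb :: "('r \<times> 'u) list \<Rightarrow> ('r, 'u) trm" where
  "lin_comb [] = TZero"
| "lin_comb (p # ps) = TAdd (TScal (fst p) (TVar (snd p))) (lin_comb ps)"

subsection \<open>Pleasant sets\<close>

text \<open>
  \<open>pp_form m H K ys xs\<close> is the formula \<open>\<exists>ys (H ys = K xs)\<close> with \<open>m\<close> rows, where \<open>ys\<close>, \<open>xs\<close> are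
  lists of variables; \<open>0 = 0\<close> is the truth constant.
\<close>

definition row_eq ::
  "(nat \<Rightarrow> nat \<Rightarrow> 'r) \<Rightarrow> (nat \<Rightarrow> nat \<Rightarrow> 'r) \<Rightarrow> 'u list \<Rightarrow> 'u list \<Rightarrow> nat \<Rightarrow> ('r, 'u) fm" where
  "row_eq H K ys xs i =
     Eq (lin_comb (map (\<lambda>j. (H i j, ys ! j)) [0..<length ys]))
        (lin_comb (map (\<lambda>k. (K i k, xs ! k)) [0..<length xs]))"

definition pp_form ::
  "nat \<Rightarrow> (nat \<Rightarrow> nat \<Rightarrow> 'r) \<Rightarrow> (nat \<Rightarrow> nat \<Rightarrow> 'r) \<Rightarrow> 'u list \<Rightarrow> 'u list \<Rightarrow> ('r, 'u) fm" where
  "pp_form m H K ys xs =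
     Ex (set ys) (foldr And (map (row_eq H K ys xs) [0..<m]) (Eq TZero TZero))"

definition pp_data ::
  "'r ring \<Rightarrow> nat \<Rightarrow> (nat \<Rightarrow> nat \<Rightarrow> 'r) \<Rightarrow> (nat \<Rightarrow> nat \<Rightarrow> 'r) \<Rightarrow> 'u list \<Rightarrow> 'u list \<Rightarrow> bool" where
  "pp_data R m H K ys xs \<longleftrightarrow>
     distinct (ys @ xs) \<and>
     (\<forall>i<m. \<forall>j<length ys. H i j \<in> carrier R) \<and>
     (\<forall>i<m. \<forall>k<length xs. K i k \<in> carrier R)"

definition id_matrix :: "'r ring \<Rightarrow> nat \<Rightarrow> nat \<Rightarrow> 'r" where
  "id_matrix R i k = (if i = k then \<one>\<^bsub>R\<^esub> else \<zero>\<^bsub>R\<^esub>)"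

text \<open>
  The formula \<open>\<exists>y (H y = z)\<close> is \<open>\<exists>y (H y = I\<^sub>m z)\<close>.  Formulas matter only up to renaming of
  variables, hence the choice of \<open>ys'\<close> and \<open>zs\<close>.
\<close>

definition pleasant_set :: "'r ring \<Rightarrow> ('r, 'u) fm set \<Rightarrow> bool" where
  "pleasant_set R \<Sigma> \<longleftrightarrow>
     (\<forall>\<phi>\<in>\<Sigma>. \<exists>m H K ys xs. pp_data R m H K ys xs \<and> \<phi> = pp_form m H K ys xs) \<and>
     (\<forall>m H K ys xs. pp_data R m H K ys xs \<and> pp_form m H K ys xs \<in> \<Sigma> \<longrightarrow>
        (\<exists>ys' zs. length ys' = length ys \<and> length zs = m \<and> distinct (ys' @ zs) \<and>
                  pp_form m H (id_matrix R) ys' zs \<in> \<Sigma>))"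

definition pleasant ::
  "'r ring \<Rightarrow> (('r, 'u) struct \<Rightarrow> ('r, 'u) struct \<Rightarrow> bool) \<Rightarrow> bool" where
  "pleasant R prec \<longleftrightarrow> (\<exists>\<Sigma>. pleasant_set R \<Sigma> \<and> prec = formula_le R \<Sigma>)"

subsection \<open>Infinitary pp-formulas\<close>

text \<open>
  \<open>ipp R \<kappa> \<mu> \<alpha> \<epsilon> \<phi>\<close> says that \<open>\<phi> \<in> \<Lambda>\<^sup>\<kappa>\<^sup>,\<^sup>\<mu>\<close> at level \<open>\<alpha>\<close> in the free variables \<open>x\<^sub>i\<close>, \<open>i < \<epsilon>\<close>.
  The ordinal \<open>i\<close> itself serves as the variable \<open>x\<^sub>i\<close>.  An ordinal \<open>\<epsilon>' \<ge> \<epsilon>\<close> is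
  \<open>\<epsilon> + \<zeta>\<close> for a unique \<open>\<zeta>\<close>, and the \<open>\<zeta>\<close> bound variables of an existential step are the \<open>x\<^sub>i\<close> with
  \<open>\<epsilon> \<le> i < \<epsilon>'\<close>; as \<open>\<mu>\<close> is an infinite cardinal, \<open>\<epsilon>, \<zeta> < \<mu>\<close> iff \<open>\<epsilon>' < \<mu>\<close>.
\<close>

inductive ipp ::
  "'r ring \<Rightarrow> 'u set \<Rightarrow> 'u set \<Rightarrow> 'u \<Rightarrow> 'u \<Rightarrow> ('r, 'u) fm \<Rightarrow> bool"
  for R :: "'r ring" and \<kappa> \<mu> :: "'u set" where
  ipp_zero:
    "ord_zero \<alpha> \<Longrightarrow> seg \<epsilon> \<prec> \<mu> \<Longrightarrow> distinct (map snd ps) \<Longrightarrow> snd ` set ps \<subseteq> seg \<epsilon> \<Longrightarrow>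
     fst ` set ps \<subseteq> carrier R \<Longrightarrow> ipp R \<kappa> \<mu> \<alpha> \<epsilon> (Eq (lin_comb ps) TZero)"
| ipp_limit:
    "ord_limit \<alpha> \<Longrightarrow> ord_less \<beta> \<alpha> \<Longrightarrow> ipp R \<kappa> \<mu> \<beta> \<epsilon> \<phi> \<Longrightarrow> ipp R \<kappa> \<mu> \<alpha> \<epsilon> \<phi>"
| ipp_succ:
    "ord_succ \<beta> \<alpha> \<Longrightarrow> seg \<epsilon> \<subseteq> seg \<epsilon>' \<Longrightarrow> seg \<epsilon>' \<prec> \<mu> \<Longrightarrow> I \<prec> \<kappa> \<Longrightarrow>
     (\<And>i. i \<in> I \<Longrightarrow> ipp R \<kappa> \<mu> \<beta> \<epsilon>' (\<Phi> i)) \<Longrightarrow>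
     ipp R \<kappa> \<mu> \<alpha> \<epsilon> (Ex (seg \<epsilon>' - seg \<epsilon>) (BigAnd I \<Phi>))"

definition Lambda_inf :: "'r ring \<Rightarrow> ('r, 'u) fm set" where
  "Lambda_inf R =
     {\<phi>. \<exists>\<kappa> \<mu> \<alpha> \<epsilon>. infinite \<mu> \<and> \<mu> \<lesssim> \<kappa> \<and> small \<kappa> \<and> ipp R \<kappa> \<mu> \<alpha> \<epsilon> \<phi>}"

definition positive_syntactic ::
  "'r ring \<Rightarrow> (('r, 'u) struct \<Rightarrow> ('r, 'u) struct \<Rightarrow> bool) \<Rightarrow> bool" where
  "positive_syntactic R prec \<longleftrightarrow> (\<exists>\<Sigma> \<subseteq> Lambda_inf R. prec = formula_le R \<Sigma>)"

subsection \<open>Weak infinitary pp-formulas\<close>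

text \<open>\<open>fo_pp R ws \<psi>\<close>: \<open>\<psi>\<close> is a first-order pp-formula in the free variables \<open>ws\<close>.\<close>

definition fo_pp :: "'r ring \<Rightarrow> 'u list \<Rightarrow> ('r, 'u) fm \<Rightarrow> bool" where
  "fo_pp R ws \<psi> \<longleftrightarrow>
     first_order R \<psi> \<and> free_vars \<psi> \<subseteq> set ws \<and>
     (\<exists>m H K zs. pp_data R m H K zs ws \<and>
        (\<forall>M\<in>R_Mod R. \<forall>a. range a \<subseteq> univ M \<longrightarrow>
           sat \<psi> M a = sat (pp_form m H K zs ws) M a))"

definition Lambda_wpp :: "'r ring \<Rightarrow> ('r, 'u) fm set" where
  "Lambda_wpp R =
     {Ex (set ys) (BigAnd I \<Psi>) | xs ys I \<Psi>.
        distinct (xs @ ys) \<and> small I \<and> (\<forall>i\<in>I. fo_pp R (xs @ ys) (\<Psi> i))}"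

definition weak_pp_le :: "'r ring \<Rightarrow> ('r, 'u) struct \<Rightarrow> ('r, 'u) struct \<Rightarrow> bool" where
  "weak_pp_le R = formula_le R (Lambda_wpp R)"

end

theory Submission
  imports Defs "HOL-Computational_Algebra.Polynomial" "HOL-Library.Countable_Set"
begin

text \<open>
  The positive part holds because pushouts amalgamate.  If a system \<open>H y = K x\<close> with \<open>x\<close> in \<open>B\<close> is
  solved in the pushout of \<open>B\<close> and \<open>C\<close> over \<open>A\<close> by \<open>b + c\<close>, then \<open>K x - H b = H c\<close> is a column of
  elements of \<open>B \<inter> C = A\<close>.  For a pleasant relation, solvability of \<open>H y = z\<close> passes from \<open>C\<close> down
  to \<open>A\<close>, so \<open>c\<close> can be replaced by a tuple of \<open>A\<close>, and \<open>B\<close> solves the original system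
  (\<open>pushout_leg_formula_le\<close>).

  The negative part exhibits a single span of abelian groups that cannot be amalgamated.  Every
  relation of the class contains all inclusions of direct summands and is closed under unions of
  chains; thus \<open>A\<close> is strong in \<open>B\<close> as soon as \<open>A\<close> is the union of a countable chain of direct
  summands of \<open>B\<close> (\<open>AEC_countable_chain_union\<close>).  Let \<open>H\<close> be generated by elements \<open>z\<^sub>k\<close> with
  \<open>2\<^sup>k\<^sup>+\<^sup>1 z\<^sub>k = e\<close> for all \<open>k\<close> and \<open>2 e = 0\<close>.  Put

    \<open>C = H \<oplus> \<langle>c\<^sub>k | 2\<^sup>k\<^sup>+\<^sup>1 c\<^sub>k = 0\<rangle>\<close> and \<open>B = \<langle>H, b\<^sub>k | 2\<^sup>k\<^sup>+\<^sup>1 b\<^sub>k = e\<rangle>\<close>,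

  and let \<open>A\<close> be generated by \<open>H\<close> and by the elements \<open>f\<^sub>k = b\<^sub>k - 2 b\<^sub>k\<^sub>+\<^sub>1 = c\<^sub>k - 2 c\<^sub>k\<^sub>+\<^sub>1\<close>.  The
  subgroup generated by \<open>H\<close> and \<open>f\<^sub>0, \<dots>, f\<^sub>n\<^sub>-\<^sub>1\<close> is a direct summand of both \<open>B\<close> and \<open>C\<close>, with
  complements generated by the \<open>b\<^sub>k - z\<^sub>k\<close> and by the \<open>c\<^sub>k\<close> for \<open>k \<ge> n\<close>
  (\<open>base_compl_disjoint\<close>, \<open>base_compl_sum\<close>).  In an amalgam, \<open>b\<^sub>0 - c\<^sub>0 = 2\<^sup>n (b\<^sub>n - c\<^sub>n)\<close> for all \<open>n\<close>,
  and twice this element is \<open>e\<close>.  So \<open>e\<close> has a half that is divisible by all powers of 2, a weak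
  infinitary pp-property that \<open>e\<close> does not have in \<open>B\<close> (\<open>no_divisible_half\<close>); this contradicts
  that \<open>B\<close> is embedded weakly infinitarily purely.  Concretely both groups are found inside one
  direct sum of copies of \<open>\<rat>/\<int>\<close>.
\<close>

section \<open>Modules, submodules and quotients\<close>

lemma left_moduleI:
  assumes "tau_structure R M"
    and "\<And>x y z. x \<in> univ M \<Longrightarrow> y \<in> univ M \<Longrightarrow> z \<in> univ M \<Longrightarrow>
           addM M (addM M x y) z = addM M x (addM M y z)"
    and "\<And>x y. x \<in> univ M \<Longrightarrow> y \<in> univ M \<Longrightarrow> addM M x y = addM M y x"
    and "\<And>x. x \<in> univ M \<Longrightarrow> addM M (zeroM M) x = x"
    and "\<And>x. x \<in> univ M \<Longrightarrow> addM M (negM M x) x = zeroM M"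
    and "\<And>r x y. r \<in> carrier R \<Longrightarrow> x \<in> univ M \<Longrightarrow> y \<in> univ M \<Longrightarrow>
           scalM M r (addM M x y) = addM M (scalM M r x) (scalM M r y)"
    and "\<And>r s x. r \<in> carrier R \<Longrightarrow> s \<in> carrier R \<Longrightarrow> x \<in> univ M \<Longrightarrow>
           scalM M (r \<oplus>\<^bsub>R\<^esub> s) x = addM M (scalM M r x) (scalM M s x)"
    and "\<And>r s x. r \<in> carrier R \<Longrightarrow> s \<in> carrier R \<Longrightarrow> x \<in> univ M \<Longrightarrow>
           scalM M (r \<otimes>\<^bsub>R\<^esub> s) x = scalM M r (scalM M s x)"
    and "\<And>x. x \<in> univ M \<Longrightarrow> scalM M \<one>\<^bsub>R\<^esub> x = x"
  shows "left_module R M"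
proof -
  have t: "zeroM M \<in> univ M" "\<And>x y. x \<in> univ M \<Longrightarrow> y \<in> univ M \<Longrightarrow> addM M x y \<in> univ M"
    "\<And>x. x \<in> univ M \<Longrightarrow> negM M x \<in> univ M"
    using assms(1) by (auto simp: tau_structure_def)
  have cg: "comm_group (add_group M)"
  proof (rule comm_groupI)
    show "x \<otimes>\<^bsub>add_group M\<^esub> y = y \<otimes>\<^bsub>add_group M\<^esub> x"
      if "x \<in> carrier (add_group M)" "y \<in> carrier (add_group M)" for x y
      using that assms(3) by simp
    show "\<exists>y\<in>carrier (add_group M). y \<otimes>\<^bsub>add_group M\<^esub> x = \<one>\<^bsub>add_group M\<^esub>"
      if "x \<in> carrier (add_group M)" for x
      using that t(3) assms(5) by (intro bexI[of _ "negM M x"]) auto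
  qed (use t assms(2,4) in simp_all)
  then interpret G: comm_group "add_group M" .
  have "negM M x = inv\<^bsub>add_group M\<^esub> x" if "x \<in> univ M" for x
    using G.inv_equality[of "negM M x" x] that t assms(5) by simp
  then show ?thesis
    unfolding left_module_def using assms cg by blast
qed

locale rmodule =
  fixes R :: "'r ring" and M :: "('r, 'a) struct"
  assumes left_module: "left_module R M"
begin

lemma tau: "tau_structure R M"
  using left_module by (simp add: left_module_def)

lemma comm_group: "comm_group (add_group M)"
  using left_module by (simp add: left_module_def)

lemma zero_closed [simp, intro]: "zeroM M \<in> univ M"
  using tau by (simp add: tau_structure_def)

lemma add_closed [simp, intro]: "x \<in> univ M \<Longrightarrow> y \<in> univ M \<Longrightarrow> addM M x y \<in> univ M"
  using tau by (simp add: tau_structure_def)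

lemma neg_closed [simp, intro]: "x \<in> univ M \<Longrightarrow> negM M x \<in> univ M"
  using tau by (simp add: tau_structure_def)

lemma scal_closed [simp, intro]: "r \<in> carrier R \<Longrightarrow> x \<in> univ M \<Longrightarrow> scalM M r x \<in> univ M"
  using tau by (simp add: tau_structure_def)

lemma add_assoc:
  "x \<in> univ M \<Longrightarrow> y \<in> univ M \<Longrightarrow> z \<in> univ M \<Longrightarrow> addM M (addM M x y) z = addM M x (addM M y z)"
  using comm_group comm_groupE(3) by fastforce

lemma add_commute: "x \<in> univ M \<Longrightarrow> y \<in> univ M \<Longrightarrow> addM M x y = addM M y x"
  using comm_groupE(4)[OF comm_group] by simp

lemma add_left_commute:
  "x \<in> univ M \<Longrightarrow> y \<in> univ M \<Longrightarrow> z \<in> univ M \<Longrightarrow> addM M x (addM M y z) = addM M y (addM M x z)"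
  by (metis add_assoc add_commute)

lemmas add_ac = add_assoc add_commute add_left_commute

lemma zero_left [simp]: "x \<in> univ M \<Longrightarrow> addM M (zeroM M) x = x"
  using comm_groupE(5)[OF comm_group] by simp

lemma zero_right [simp]: "x \<in> univ M \<Longrightarrow> addM M x (zeroM M) = x"
  using add_commute by fastforce

lemma neg_left [simp]: "x \<in> univ M \<Longrightarrow> addM M (negM M x) x = zeroM M"
proof -
  assume x: "x \<in> univ M"
  interpret G: comm_group "add_group M" by (rule comm_group)
  show ?thesis using G.l_inv[of x] x left_module by (simp add: left_module_def)
qed

lemma neg_right [simp]: "x \<in> univ M \<Longrightarrow> addM M x (negM M x) = zeroM M"
  using add_commute by fastforce

lemma add_neg_cancel [simp]:
  "x \<in> univ M \<Longrightarrow> y \<in> univ M \<Longrightarrow> addM M x (addM M (negM M x) y) = y"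
  "x \<in> univ M \<Longrightarrow> y \<in> univ M \<Longrightarrow> addM M (negM M x) (addM M x y) = y"
  by (simp_all flip: add_assoc)

lemma add_cancel:
  "x \<in> univ M \<Longrightarrow> y \<in> univ M \<Longrightarrow> z \<in> univ M \<Longrightarrow> addM M x y = addM M x z \<longleftrightarrow> y = z"
  by (metis add_neg_cancel(2))

lemma neg_unique: "x \<in> univ M \<Longrightarrow> y \<in> univ M \<Longrightarrow> addM M x y = zeroM M \<Longrightarrow> negM M x = y"
  by (metis add_cancel neg_closed neg_right)

lemma neg_add: 
  "x \<in> univ M \<Longrightarrow> y \<in> univ M \<Longrightarrow> negM M (addM M x y) = addM M (negM M x) (negM M y)"
proof (rule neg_unique)
  assume xy: "x \<in> univ M" "y \<in> univ M"
  have "addM M (addM M x y) (addM M (negM M x) (negM M y))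
      = addM M (addM M x (negM M x)) (addM M y (negM M y))"
    using xy by (simp add: add_ac del: neg_right add_neg_cancel)
  then show "addM M (addM M x y) (addM M (negM M x) (negM M y)) = zeroM M"
    using xy by simp
qed auto

lemma neg_neg [simp]: "x \<in> univ M \<Longrightarrow> negM M (negM M x) = x"
  by (rule neg_unique) auto

lemma neg_zero [simp]: "negM M (zeroM M) = zeroM M"
  by (rule neg_unique) auto

lemma diff_eq_zero:
  "x \<in> univ M \<Longrightarrow> y \<in> univ M \<Longrightarrow> addM M x (negM M y) = zeroM M \<longleftrightarrow> x = y"
  by (metis neg_neg neg_right neg_closed neg_unique add_commute)

lemma eq_add_iff:
  "x \<in> univ M \<Longrightarrow> y \<in> univ M \<Longrightarrow> z \<in> univ M \<Longrightarrow> addM M x y = z \<longleftrightarrow> y = addM M z (negM M x)"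
  by (metis add_commute add_neg_cancel neg_closed)

lemma scal_add:
  "r \<in> carrier R \<Longrightarrow> x \<in> univ M \<Longrightarrow> y \<in> univ M \<Longrightarrow>
   scalM M r (addM M x y) = addM M (scalM M r x) (scalM M r y)"
  using left_module by (simp add: left_module_def)

lemma add_scal:
  "r \<in> carrier R \<Longrightarrow> s \<in> carrier R \<Longrightarrow> x \<in> univ M \<Longrightarrow>
   scalM M (r \<oplus>\<^bsub>R\<^esub> s) x = addM M (scalM M r x) (scalM M s x)"
  using left_module by (simp add: left_module_def)

lemma scal_scal:
  "r \<in> carrier R \<Longrightarrow> s \<in> carrier R \<Longrightarrow> x \<in> univ M \<Longrightarrow>
   scalM M (r \<otimes>\<^bsub>R\<^esub> s) x = scalM M r (scalM M s x)"
  using left_module by (simp add: left_module_def)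

lemma one_scal [simp]: "x \<in> univ M \<Longrightarrow> scalM M \<one>\<^bsub>R\<^esub> x = x"
  using left_module by (simp add: left_module_def)

lemma scal_zero [simp]: "r \<in> carrier R \<Longrightarrow> scalM M r (zeroM M) = zeroM M"
  by (metis add_cancel scal_add scal_closed zero_closed zero_right)

lemma zero_scal: "ring R \<Longrightarrow> x \<in> univ M \<Longrightarrow> scalM M \<zero>\<^bsub>R\<^esub> x = zeroM M"
proof -
  assume R: "ring R" and x: "x \<in> univ M"
  interpret ring R by (rule R)
  have "addM M (scalM M \<zero>\<^bsub>R\<^esub> x) (scalM M \<zero>\<^bsub>R\<^esub> x) = addM M (scalM M \<zero>\<^bsub>R\<^esub> x) (zeroM M)"
    using add_scal[of "\<zero>\<^bsub>R\<^esub>" "\<zero>\<^bsub>R\<^esub>" x] x by simp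
  then show ?thesis
    using x by (subst (asm) add_cancel) auto
qed

lemma scal_neg:
  "r \<in> carrier R \<Longrightarrow> x \<in> univ M \<Longrightarrow> scalM M r (negM M x) = negM M (scalM M r x)"
  by (metis neg_closed neg_right neg_unique scal_add scal_closed scal_zero)

end

definition mod_hom :: "'r ring \<Rightarrow> ('a \<Rightarrow> 'b) \<Rightarrow> ('r, 'a) struct \<Rightarrow> ('r, 'b) struct \<Rightarrow> bool" where
  "mod_hom R f X Y \<longleftrightarrow>
     f ` univ X \<subseteq> univ Y \<and> f (zeroM X) = zeroM Y \<and>
     (\<forall>x\<in>univ X. \<forall>y\<in>univ X. f (addM X x y) = addM Y (f x) (f y)) \<and>
     (\<forall>x\<in>univ X. f (negM X x) = negM Y (f x)) \<and>
     (\<forall>r\<in>carrier R. \<forall>x\<in>univ X. f (scalM X r x) = scalM Y r (f x))"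

definition is_submodule :: "'r ring \<Rightarrow> 'a set \<Rightarrow> ('r, 'a) struct \<Rightarrow> bool" where
  "is_submodule R S M \<longleftrightarrow>
     S \<subseteq> univ M \<and> zeroM M \<in> S \<and> (\<forall>x\<in>S. \<forall>y\<in>S. addM M x y \<in> S) \<and>
     (\<forall>x\<in>S. negM M x \<in> S) \<and> (\<forall>r\<in>carrier R. \<forall>x\<in>S. scalM M r x \<in> S)"

definition restrict_struct :: "'r ring \<Rightarrow> 'a set \<Rightarrow> ('r, 'a) struct \<Rightarrow> ('r, 'a) struct" where
  "restrict_struct R S M =
     \<lparr>univ = S, zeroM = zeroM M,
      addM = (\<lambda>x y. if x \<in> S \<and> y \<in> S then addM M x y else undefined),
      negM = (\<lambda>x. if x \<in> S then negM M x else undefined),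
      scalM = (\<lambda>r x. if r \<in> carrier R \<and> x \<in> S then scalM M r x else undefined)\<rparr>"

lemma univ_restrict [simp]: "univ (restrict_struct R S M) = S"
  by (simp add: restrict_struct_def)

lemma tau_restrict: "is_submodule R S M \<Longrightarrow> tau_structure R (restrict_struct R S M)"
  by (auto simp: is_submodule_def tau_structure_def restrict_struct_def)

lemma left_module_restrict:
  assumes R: "ring R" and "left_module R M" and S: "is_submodule R S M"
  shows "left_module R (restrict_struct R S M)"
proof -
  interpret ring R by (rule R)
  interpret rmodule R M by standard fact
  have sub: "\<And>x. x \<in> S \<Longrightarrow> x \<in> univ M" using S by (auto simp: is_submodule_def)
  note S' = S[unfolded is_submodule_def]
  show ?thesis
    by (rule left_moduleI[OF tau_restrict[OF S]])
       (use S' in \<open>auto simp: restrict_struct_def sub add_ac scal_add add_scal scal_scal simp del: add_neg_cancel\<close>)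
qed

lemma substructure_restrict:
  assumes "tau_structure R M" "is_submodule R S M"
  shows "substructure R (restrict_struct R S M) M"
  using assms tau_restrict[OF assms(2)]
  by (auto simp: substructure_def restrict_struct_def is_submodule_def)

lemma substructure_restrict_restrict:
  assumes "is_submodule R S M" "is_submodule R T M" "S \<subseteq> T"
  shows "substructure R (restrict_struct R S M) (restrict_struct R T M)"
  using assms tau_restrict[OF assms(1)] tau_restrict[OF assms(2)]
  by (auto simp: substructure_def restrict_struct_def is_submodule_def)

lemma is_submodule_image:
  assumes X: "left_module R X" and f: "mod_hom R f X Y" and S: "is_submodule R S X"
  shows "is_submodule R (f ` S) Y"
proof -
  have sub: "\<And>x. x \<in> S \<Longrightarrow> x \<in> univ X" using S by (auto simp: is_submodule_def)
  have "zeroM Y \<in> f ` S" using f S by (auto simp: is_submodule_def mod_hom_def intro!: image_eqI[of _ _ "zeroM X"])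
  moreover have "addM Y (f x) (f y) \<in> f ` S" if "x \<in> S" "y \<in> S" for x y
    using f S that by (auto simp: is_submodule_def mod_hom_def sub intro!: image_eqI[of _ _ "addM X x y"])
  moreover have "negM Y (f x) \<in> f ` S" if "x \<in> S" for x
    using f S that by (auto simp: is_submodule_def mod_hom_def sub intro!: image_eqI[of _ _ "negM X x"])
  moreover have "scalM Y r (f x) \<in> f ` S" if "x \<in> S" "r \<in> carrier R" for r x
    using f S that by (auto simp: is_submodule_def mod_hom_def sub intro!: image_eqI[of _ _ "scalM X r x"])
  ultimately show ?thesis using f by (auto simp: is_submodule_def mod_hom_def sub)
qed

lemma is_submodule_univ: "left_module R X \<Longrightarrow> is_submodule R (univ X) X"
  using rmodule.tau[of R X] by (auto simp: rmodule_def is_submodule_def tau_structure_def)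

lemma substructure_hom: "substructure R A B \<Longrightarrow> mod_hom R (\<lambda>x. x) A B"
  by (auto simp: substructure_def mod_hom_def)

lemma iso_onto_image:
  assumes X: "left_module R X" and Y: "left_module R Y"
    and f: "mod_hom R f X Y" and inj: "inj_on f (univ X)"
  shows "iso_struct R f X (restrict_struct R (f ` univ X) Y)"
proof -
  have "tau_structure R (restrict_struct R (f ` univ X) Y)"
    by (intro tau_restrict is_submodule_image[OF X f] is_submodule_univ X)
  with X f inj show ?thesis
    by (auto simp: iso_struct_def restrict_struct_def mod_hom_def left_module_def bij_betw_def)
qed

lemma left_module_hom_image:
  assumes R: "ring R" and X: "left_module R X" and f: "mod_hom R f X Y" and "univ Y = f ` univ X"
    and Y: "tau_structure R Y"
  shows "left_module R Y"
proof -
  interpret ring R by (rule R)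
  interpret X: rmodule R X by standard (rule X)
  have h: "\<And>x y. x \<in> univ X \<Longrightarrow> y \<in> univ X \<Longrightarrow> addM Y (f x) (f y) = f (addM X x y)"
    "zeroM Y = f (zeroM X)"
    "\<And>x. x \<in> univ X \<Longrightarrow> negM Y (f x) = f (negM X x)"
    "\<And>r x. r \<in> carrier R \<Longrightarrow> x \<in> univ X \<Longrightarrow> scalM Y r (f x) = f (scalM X r x)"
    using f by (auto simp: mod_hom_def)
  show ?thesis
    by (rule left_moduleI[OF Y])
       (use assms(4) in \<open>auto simp: h X.scal_add X.add_scal X.scal_scal X.add_ac\<close>)
qed

text \<open>
  A quotient consists of cosets, whereas every module here has to live inside a fixed universe.  A chosen representative of each coset, carried over by \<open>\<iota>\<close>, does the job,
  and the map to representatives is the canonical projection \<open>q\<close>.  With \<open>X\<close> of another type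
  than the quotient, the lemma also transports modules into the universe.
\<close>

lemma quotient_module_exists:
  fixes X :: "('r, 'a) struct" and \<iota> :: "'a \<Rightarrow> 'u"
  assumes R: "ring R" and X: "left_module R X" and N: "is_submodule R N X"
    and \<iota>: "inj_on \<iota> (univ X)"
  obtains q :: "'a \<Rightarrow> 'u" and Y where
    "left_module R Y" "mod_hom R q X Y" "univ Y = q ` univ X"
    "\<And>x y. x \<in> univ X \<Longrightarrow> y \<in> univ X \<Longrightarrow> q x = q y \<longleftrightarrow> addM X x (negM X y) \<in> N"
proof -
  interpret X: rmodule R X by standard (rule X)
  define d where "d x y = addM X x (negM X y)" for x y
  define rep where "rep x = (SOME y. y \<in> univ X \<and> d x y \<in> N)" for x
  define q where "q x = \<iota> (rep x)" for x
  have Nsub: "\<And>x. x \<in> N \<Longrightarrow> x \<in> univ X" and Nadd: "\<And>x y. x \<in> N \<Longrightarrow> y \<in> N \<Longrightarrow> addM X x y \<in> N"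
    and Nneg: "\<And>x. x \<in> N \<Longrightarrow> negM X x \<in> N" and N0: "zeroM X \<in> N"
    and Nscal: "\<And>r x. r \<in> carrier R \<Longrightarrow> x \<in> N \<Longrightarrow> scalM X r x \<in> N"
    using N by (auto simp: is_submodule_def)
  have refl: "d x x \<in> N" if "x \<in> univ X" for x using that N0 by (simp add: d_def)
  have sym: "d y x \<in> N" if "d x y \<in> N" "x \<in> univ X" "y \<in> univ X" for x y
    using Nneg[OF that(1)] that by (simp add: d_def X.neg_add X.add_commute)
  have trans: "d x z \<in> N" if "d x y \<in> N" "d y z \<in> N" "x \<in> univ X" "y \<in> univ X" "z \<in> univ X" for x y z
    using Nadd[OF that(1,2)] that by (simp add: d_def X.add_assoc)
  have rep: "rep x \<in> univ X \<and> d x (rep x) \<in> N" if "x \<in> univ X" for x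
    unfolding rep_def by (rule someI[of _ x]) (use that refl in auto)
  have rep_eq: "rep x = rep y \<longleftrightarrow> d x y \<in> N" if "x \<in> univ X" "y \<in> univ X" for x y
  proof
    assume "rep x = rep y"
    then show "d x y \<in> N" using rep[OF that(1)] rep[OF that(2)] sym trans that by metis
  next
    assume "d x y \<in> N"
    then have "z \<in> univ X \<and> d x z \<in> N \<longleftrightarrow> z \<in> univ X \<and> d y z \<in> N" for z
      using sym trans that by metis
    then show "rep x = rep y" unfolding rep_def by presburger
  qed
  have q_eq: "q x = q y \<longleftrightarrow> d x y \<in> N" if "x \<in> univ X" "y \<in> univ X" for x y
    using rep_eq[OF that] rep that \<iota> by (auto simp: q_def inj_on_def)
  define g where "g = inv_into (univ X) q"
  have g: "g (q x) \<in> univ X" "d (g (q x)) x \<in> N" if "x \<in> univ X" for x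
  proof -
    show 1: "g (q x) \<in> univ X" using that by (simp add: g_def inv_into_into)
    have "q (g (q x)) = q x" using that by (simp add: g_def f_inv_into_f)
    then show "d (g (q x)) x \<in> N" using q_eq 1 that by blast
  qed
  define Y where "Y = \<lparr>univ = q ` univ X, zeroM = q (zeroM X),
      addM = (\<lambda>u v. if u \<in> q ` univ X \<and> v \<in> q ` univ X then q (addM X (g u) (g v)) else undefined),
      negM = (\<lambda>u. if u \<in> q ` univ X then q (negM X (g u)) else undefined),
      scalM = (\<lambda>r u. if r \<in> carrier R \<and> u \<in> q ` univ X then q (scalM X r (g u)) else undefined)\<rparr>"
  have add: "q (addM X (g (q x)) (g (q y))) = q (addM X x y)" if "x \<in> univ X" "y \<in> univ X" for x y
  proof -
    have "d (addM X (g (q x)) (g (q y))) (addM X x y) = addM X (d (g (q x)) x) (d (g (q y)) y)"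
      using g(1) that by (simp add: d_def X.neg_add X.add_ac)
    then have "d (addM X (g (q x)) (g (q y))) (addM X x y) \<in> N"
      using g(2)[OF that(1)] g(2)[OF that(2)] Nadd by simp
    then show ?thesis using q_eq g(1) that by blast
  qed
  have neg: "q (negM X (g (q x))) = q (negM X x)" if "x \<in> univ X" for x
  proof -
    have "d (negM X (g (q x))) (negM X x) = negM X (d (g (q x)) x)"
      using g(1) that by (simp add: d_def X.neg_add)
    then have "d (negM X (g (q x))) (negM X x) \<in> N" using g(2)[OF that] Nneg by simp
    then show ?thesis using q_eq g(1) that by blast
  qed
  have scal: "q (scalM X r (g (q x))) = q (scalM X r x)" if "x \<in> univ X" "r \<in> carrier R" for r x
  proof -
    have "d (scalM X r (g (q x))) (scalM X r x) = scalM X r (d (g (q x)) x)"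
      using g(1) that by (simp add: d_def X.scal_add X.scal_neg)
    then have "d (scalM X r (g (q x))) (scalM X r x) \<in> N" using g(2)[OF that(1)] Nscal that by simp
    then show ?thesis using q_eq g(1) that by blast
  qed
  have hom: "mod_hom R q X Y"
    by (auto simp: mod_hom_def Y_def add neg scal)
  have tau: "tau_structure R Y"
    by (auto simp: tau_structure_def Y_def add neg scal)
  have uY: "univ Y = q ` univ X" by (simp add: Y_def)
  show ?thesis
    by (rule that[OF left_module_hom_image[OF R X hom uY tau] hom uY]) (use q_eq d_def in auto)
qed

section \<open>Finite systems of linear equations\<close>

text \<open>
  The list of indices makes inductions on the length of a row possible; the case of interest is
  \<open>[0..<n]\<close>, where this is one row of the product of a matrix with a column.
\<close>

primrec lin_form ::
  "('r, 'a) struct \<Rightarrow> (nat \<Rightarrow> 'r) \<Rightarrow> (nat \<Rightarrow> 'a) \<Rightarrow> nat list \<Rightarrow> 'a" where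
  "lin_form M h b [] = zeroM M"
| "lin_form M h b (j # js) = addM M (scalM M (h j) (b j)) (lin_form M h b js)"

lemma trm_val_lin_comb:
  "trm_val M a (lin_comb (map (\<lambda>j. (h j, v j)) js)) = lin_form M h (\<lambda>j. a (v j)) js"
  by (induction js) auto

lemma lin_form_cong:
  "(\<And>j. j \<in> set js \<Longrightarrow> b j = c j) \<Longrightarrow> lin_form M h b js = lin_form M h c js"
  by (induction js) auto

lemma sat_foldr_And:
  "sat (foldr And fs (Eq TZero TZero)) M a \<longleftrightarrow> (\<forall>f\<in>set fs. sat f M a)"
  by (induction fs) auto

lemma sat_pp_form:
  assumes "distinct (ys @ xs)"
  shows "sat (pp_form m H K ys xs) M a \<longleftrightarrow>
    (\<exists>b. (\<forall>j<length ys. b j \<in> univ M) \<and>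
         (\<forall>i<m. lin_form M (H i) b [0..<length ys] =
                lin_form M (K i) (\<lambda>k. a (xs ! k)) [0..<length xs]))" (is "?L \<longleftrightarrow> ?R")
proof -
  have disj: "xs ! k \<notin> set ys" if "k < length xs" for k
    using assms that nth_mem by fastforce
  have val: "sat (row_eq H K ys xs i) M (override_on a c (set ys)) \<longleftrightarrow>
     lin_form M (H i) (\<lambda>j. c (ys ! j)) [0..<length ys] =
     lin_form M (K i) (\<lambda>k. a (xs ! k)) [0..<length xs]" for c i
  proof -
    have "lin_form M (H i) (\<lambda>j. override_on a c (set ys) (ys ! j)) [0..<length ys]
        = lin_form M (H i) (\<lambda>j. c (ys ! j)) [0..<length ys]"
      by (rule lin_form_cong) simp
    moreover have "lin_form M (K i) (\<lambda>k. override_on a c (set ys) (xs ! k)) [0..<length xs]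
        = lin_form M (K i) (\<lambda>k. a (xs ! k)) [0..<length xs]"
      by (rule lin_form_cong) (use disj in simp)
    ultimately show ?thesis by (simp add: row_eq_def trm_val_lin_comb)
  qed
  have L: "?L \<longleftrightarrow> (\<exists>c. (\<forall>y\<in>set ys. c y \<in> univ M) \<and>
      (\<forall>i<m. lin_form M (H i) (\<lambda>j. c (ys ! j)) [0..<length ys] =
             lin_form M (K i) (\<lambda>k. a (xs ! k)) [0..<length xs]))"
    by (auto simp: pp_form_def sat_foldr_And val)
  show ?thesis
  proof
    assume ?L
    then obtain c where c: "\<forall>y\<in>set ys. c y \<in> univ M"
      "\<forall>i<m. lin_form M (H i) (\<lambda>j. c (ys ! j)) [0..<length ys] =
             lin_form M (K i) (\<lambda>k. a (xs ! k)) [0..<length xs]" using L by blast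
    show ?R by (rule exI[of _ "\<lambda>j. c (ys ! j)"]) (use c in auto)
  next
    assume ?R
    then obtain b where b: "\<forall>j<length ys. b j \<in> univ M"
      "\<forall>i<m. lin_form M (H i) b [0..<length ys] =
             lin_form M (K i) (\<lambda>k. a (xs ! k)) [0..<length xs]" by blast
    define c where "c y = b (THE j. j < length ys \<and> ys ! j = y)" for y
    have c: "c (ys ! j) = b j" if "j < length ys" for j
    proof -
      have "(THE i. i < length ys \<and> ys ! i = ys ! j) = j"
        using that assms by (intro the_equality) (auto simp: nth_eq_iff_index_eq)
      then show ?thesis by (simp add: c_def)
    qed
    have "lin_form M (H i) (\<lambda>j. c (ys ! j)) [0..<length ys] = lin_form M (H i) b [0..<length ys]" for i
      by (rule lin_form_cong) (use c in simp)
    moreover have "\<forall>y\<in>set ys. c y \<in> univ M"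
      using b(1) c by (metis in_set_conv_nth)
    ultimately show ?L using b(2) L by auto
  qed
qed

context rmodule
begin

lemma lin_form_closed:
  "(\<And>j. j \<in> set js \<Longrightarrow> h j \<in> carrier R \<and> b j \<in> univ M) \<Longrightarrow> lin_form M h b js \<in> univ M"
  by (induction js) simp_all

lemma lin_form_add:
  "(\<And>j. j \<in> set js \<Longrightarrow> h j \<in> carrier R \<and> b j \<in> univ M \<and> c j \<in> univ M) \<Longrightarrow>
   lin_form M h (\<lambda>j. addM M (b j) (c j)) js = addM M (lin_form M h b js) (lin_form M h c js)"
proof (induction js)
  case (Cons j js)
  have IH: "lin_form M h (\<lambda>j. addM M (b j) (c j)) js = addM M (lin_form M h b js) (lin_form M h c js)"
    by (rule Cons.IH) (use Cons.prems in simp)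
  have cl: "lin_form M h b js \<in> univ M" "lin_form M h c js \<in> univ M"
    by (rule lin_form_closed; use Cons.prems in simp)+
  have j: "h j \<in> carrier R" "b j \<in> univ M" "c j \<in> univ M"
    using Cons.prems[of j] by simp_all
  then have "scalM M (h j) (b j) \<in> univ M" "scalM M (h j) (c j) \<in> univ M" by auto
  with cl show ?case
    by (simp only: lin_form.simps IH scal_add[OF j] add_ac add_closed)
qed simp

lemma lin_form_id_matrix:
  assumes "ring R" "distinct js" "\<And>j. j \<in> set js \<Longrightarrow> b j \<in> univ M"
  shows "lin_form M (id_matrix R i) b js = (if i \<in> set js then b i else zeroM M)"
  using assms(2,3)
proof (induction js)
  case (Cons j js)
  have IH: "lin_form M (id_matrix R i) b js = (if i \<in> set js then b i else zeroM M)"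
    by (rule Cons.IH) (use Cons.prems in simp_all)
  have j: "b j \<in> univ M" "j \<notin> set js" using Cons.prems by simp_all
  show ?case
  proof (cases "i = j")
    case True
    then have "lin_form M (id_matrix R i) b js = zeroM M" using IH j by simp
    then show ?thesis using j True by (simp add: id_matrix_def[of R j j])
  next
    case False
    have "(if i \<in> set js then b i else zeroM M) \<in> univ M" using Cons.prems by simp
    then show ?thesis using j False by (simp add: IH id_matrix_def[of R i j] zero_scal[OF assms(1)])
  qed
qed simp

end

lemma lin_form_hom:
  assumes "left_module R X" "mod_hom R f X Y"
    "\<And>j. j \<in> set js \<Longrightarrow> h j \<in> carrier R \<and> b j \<in> univ X"
  shows "lin_form Y h (\<lambda>j. f (b j)) js = f (lin_form X h b js)"
  using assms(3)
proof (induction js)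
  case (Cons j js)
  interpret X: rmodule R X by standard (rule assms)
  have IH: "lin_form Y h (\<lambda>j. f (b j)) js = f (lin_form X h b js)"
    by (rule Cons.IH) (use Cons.prems in simp)
  have "lin_form X h b js \<in> univ X" by (rule X.lin_form_closed) (use Cons.prems in simp)
  moreover have "h j \<in> carrier R" "b j \<in> univ X" using Cons.prems[of j] by simp_all
  ultimately show ?case using assms(2) by (simp add: IH mod_hom_def)
qed (use assms(2) in \<open>simp add: mod_hom_def\<close>)

text \<open>
  Homomorphisms carry solutions to solutions.  In particular only one direction is ever at stake
  when a submodule is tested for the relation given by pp-formulas.
\<close>

lemma sat_pp_form_hom:
  assumes "left_module R X" "mod_hom R f X Y" and d: "pp_data R m H K ys xs"
    and a: "range a \<subseteq> univ X"
    and s: "sat (pp_form m H K ys xs) X a"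
  shows "sat (pp_form m H K ys xs) Y (\<lambda>v. f (a v))"
proof -
  have dis: "distinct (ys @ xs)" using d by (simp add: pp_data_def)
  obtain b where b: "\<forall>j<length ys. b j \<in> univ X"
    "\<forall>i<m. lin_form X (H i) b [0..<length ys] =
           lin_form X (K i) (\<lambda>k. a (xs ! k)) [0..<length xs]"
    using s sat_pp_form[OF dis] by blast
  have "lin_form Y (H i) (\<lambda>j. f (b j)) [0..<length ys] =
        lin_form Y (K i) (\<lambda>k. f (a (xs ! k))) [0..<length xs]" if "i < m" for i
  proof -
    have "lin_form Y (H i) (\<lambda>j. f (b j)) [0..<length ys] = f (lin_form X (H i) b [0..<length ys])"
      by (rule lin_form_hom[OF assms(1,2)]) (use b(1) d that in \<open>simp add: pp_data_def\<close>)
    moreover have "lin_form Y (K i) (\<lambda>k. f (a (xs ! k))) [0..<length xs]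
        = f (lin_form X (K i) (\<lambda>k. a (xs ! k)) [0..<length xs])"
      by (rule lin_form_hom[OF assms(1,2)]) (use a d that in \<open>simp add: pp_data_def image_subset_iff\<close>)
    ultimately show ?thesis using b(2) that by simp
  qed
  moreover have "\<forall>j<length ys. f (b j) \<in> univ Y"
    using b(1) assms(2) by (auto simp: mod_hom_def)
  ultimately show ?thesis
    unfolding sat_pp_form[OF dis] by (intro exI[of _ "\<lambda>j. f (b j)"] conjI allI impI) simp_all
qed

section \<open>Amalgamation for pleasant relations\<close>

text \<open>
  This is where pleasantness enters.  Write a solution in \<open>D\<close> of a system \<open>H y = K x\<close> with
  \<open>x\<close> in \<open>B\<close> as \<open>b + c\<close>.  Then \<open>K x - H b\<close> lies in \<open>B\<close> and equals \<open>H c\<close>, which lies in \<open>C\<close>;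
  as \<open>B\<close> and \<open>C\<close> meet only in \<open>A\<close>, the column \<open>H c\<close> consists of elements of \<open>A\<close>.  The formula
  with the same left-hand side and a free right-hand side is true of this column in \<open>C\<close>, hence
  in \<open>A\<close>, and replacing \<open>c\<close> by a solution from \<open>A\<close> gives a solution in \<open>B\<close>.  The hypotheses
  describe a pushout without fixing a construction, so that the lemma serves for both legs.
\<close>

lemma pushout_leg_formula_le:
  fixes R :: "'r ring" and A B C D :: "('r, 'u) struct" and f g :: "'u \<Rightarrow> 'u"
  assumes R: "ring R"
    and B: "B \<in> R_Mod R" and D: "D \<in> R_Mod R"
    and \<Sigma>: "pleasant_set R \<Sigma>" and AC: "formula_le R \<Sigma> A C" and AB: "substructure R A B"
    and f: "mod_hom R f B D" and g: "mod_hom R g C D"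
    and cover: "\<And>d. d \<in> univ D \<Longrightarrow> \<exists>b\<in>univ B. \<exists>c\<in>univ C. d = addM D (f b) (g c)"
    and glue: "\<And>b c. b \<in> univ B \<Longrightarrow> c \<in> univ C \<Longrightarrow> f b = g c \<Longrightarrow> b = c \<and> b \<in> univ A"
  shows "formula_le R \<Sigma> (restrict_struct R (f ` univ B) D) D"
proof -
  have mods: "left_module R A" "left_module R B" "left_module R C" "left_module R D"
    using B D AC by (auto simp: R_Mod_def formula_le_def submodule_le_def)
  interpret A: rmodule R A by standard (rule mods)
  interpret B: rmodule R B by standard (rule mods)
  interpret C: rmodule R C by standard (rule mods)
  interpret D: rmodule R D by standard (rule mods)
  define E where "E = restrict_struct R (f ` univ B) D"
  have subm: "is_submodule R (f ` univ B) D"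
    by (rule is_submodule_image[OF mods(2) f is_submodule_univ[OF mods(2)]])
  have ED: "substructure R E D"
    unfolding E_def by (rule substructure_restrict[OF D.tau subm])
  have modE: "left_module R E"
    unfolding E_def by (rule left_module_restrict[OF R mods(4) subm])
  have fE: "mod_hom R f B E"
    using f by (auto simp: mod_hom_def E_def restrict_struct_def)
  have "small (univ E)"
    using D subset_imp_lepoll[of "univ E" "univ D"] lesspoll_trans1 ED
    by (auto simp: R_Mod_def small_def substructure_def)
  then have "submodule_le R E D"
    using modE D ED by (auto simp: submodule_le_def R_Mod_def)
  moreover have "sat \<phi> E a = sat \<phi> D a" if \<phi>: "\<phi> \<in> \<Sigma>" and a: "range a \<subseteq> univ E" for \<phi> a
  proof -
    obtain m H K ys xs where d: "pp_data R m H K ys xs" and \<phi>_eq: "\<phi> = pp_form m H K ys xs"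
      using \<Sigma> \<phi> unfolding pleasant_set_def by blast
    have dis: "distinct (ys @ xs)" using d by (simp add: pp_data_def)
    have H: "H i j \<in> carrier R" if "i < m" "j < length ys" for i j
      using d that by (simp add: pp_data_def)
    have K: "K i j \<in> carrier R" if "i < m" "j < length xs" for i j
      using d that by (simp add: pp_data_def)
    obtain a' where a': "range a' \<subseteq> univ B" "\<And>v. a v = f (a' v)"
    proof -
      have "\<forall>v. \<exists>b. b \<in> univ B \<and> a v = f b" using a by (auto simp: E_def)
      then obtain a' where "\<forall>v. a' v \<in> univ B \<and> a v = f (a' v)" by metis
      then show ?thesis using that[of a'] by blast
    qed
    have a'v: "a' v \<in> univ B" for v using a'(1) by auto
    show ?thesis
    proof
      assume "sat \<phi> E a"
      then show "sat \<phi> D a"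
        using sat_pp_form_hom[OF modE substructure_hom[OF ED] d a] by (simp add: \<phi>_eq)
    next
      assume "sat \<phi> D a"
      then obtain y where y: "\<forall>j<length ys. y j \<in> univ D"
        "\<forall>i<m. lin_form D (H i) y [0..<length ys] =
               lin_form D (K i) (\<lambda>k. a (xs ! k)) [0..<length xs]"
        using sat_pp_form[OF dis] \<phi>_eq by blast
      have "\<forall>j. \<exists>b c. j < length ys \<longrightarrow> b \<in> univ B \<and> c \<in> univ C \<and> y j = addM D (f b) (g c)"
        using cover y(1) by blast
      then obtain b c where bc: "\<And>j. j < length ys \<Longrightarrow> b j \<in> univ B"
        "\<And>j. j < length ys \<Longrightarrow> c j \<in> univ C"
        "\<And>j. j < length ys \<Longrightarrow> y j = addM D (f (b j)) (g (c j))" by metis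
      define Hb where "Hb i = lin_form B (H i) b [0..<length ys]" for i
      define Hc where "Hc i = lin_form C (H i) c [0..<length ys]" for i
      define Ka where "Ka i = lin_form B (K i) (\<lambda>k. a' (xs ! k)) [0..<length xs]" for i
      have cl: "Hb i \<in> univ B" "Hc i \<in> univ C" "Ka i \<in> univ B" if "i < m" for i
        unfolding Hb_def Hc_def Ka_def
        by (rule B.lin_form_closed C.lin_form_closed; use that bc a'v H K in simp)+
      \<comment> \<open>Row by row, the difference \<open>K x - H b\<close> in \<open>B\<close> is identified with \<open>H c\<close> in \<open>C\<close>,
         so both are one and the same element of \<open>A\<close>.\<close>
      have row: "addM B (Ka i) (negM B (Hb i)) = Hc i \<and> Hc i \<in> univ A" if i: "i < m" for i
      proof -
        have "lin_form D (H i) y [0..<length ys]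
            = lin_form D (H i) (\<lambda>j. addM D (f (b j)) (g (c j))) [0..<length ys]"
          by (rule lin_form_cong) (use bc in simp)
        also have "\<dots> = addM D (lin_form D (H i) (\<lambda>j. f (b j)) [0..<length ys])
                               (lin_form D (H i) (\<lambda>j. g (c j)) [0..<length ys])"
          by (rule D.lin_form_add) (use H i f g bc in \<open>auto simp: mod_hom_def\<close>)
        also have "lin_form D (H i) (\<lambda>j. f (b j)) [0..<length ys] = f (Hb i)"
          unfolding Hb_def by (rule lin_form_hom[OF mods(2) f]) (use H i bc in auto)
        also have "lin_form D (H i) (\<lambda>j. g (c j)) [0..<length ys] = g (Hc i)"
          unfolding Hc_def by (rule lin_form_hom[OF mods(3) g]) (use H i bc in auto)
        finally have "addM D (f (Hb i)) (g (Hc i))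
            = lin_form D (K i) (\<lambda>k. f (a' (xs ! k))) [0..<length xs]"
          using y(2) i a'(2) by simp
        also have "\<dots> = f (Ka i)"
          unfolding Ka_def by (rule lin_form_hom[OF mods(2) f]) (use K i a'v in auto)
        finally have "g (Hc i) = addM D (f (Ka i)) (negM D (f (Hb i)))"
          using cl[OF i] f g by (subst (asm) D.eq_add_iff) (auto simp: mod_hom_def)
        also have "\<dots> = f (addM B (Ka i) (negM B (Hb i)))"
          using cl[OF i] f by (auto simp: mod_hom_def)
        finally show ?thesis
          using glue[of "addM B (Ka i) (negM B (Hb i))" "Hc i"] cl[OF i] by auto
      qed
      have "pp_form m H K ys xs \<in> \<Sigma>" using \<phi> \<phi>_eq by simp
      \<comment> \<open>Pleasantness lets the right-hand side vary freely; it is then set to the column \<open>H c\<close>.\<close>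
      then obtain ys' zs where z: "length ys' = length ys" "length zs = m" "distinct (ys' @ zs)"
        "pp_form m H (id_matrix R) ys' zs \<in> \<Sigma>"
        using \<Sigma> d unfolding pleasant_set_def by blast
      define s where "s v = (if v \<in> set zs then Hc (THE i. i < m \<and> zs ! i = v) else zeroM A)" for v
      have s_zs: "s (zs ! i) = Hc i" if "i < m" for i
      proof -
        have "(THE j. j < m \<and> zs ! j = zs ! i) = i"
          using that z by (intro the_equality) (auto simp: nth_eq_iff_index_eq)
        then show ?thesis using that z(2) by (simp add: s_def)
      qed
      have s_A: "range s \<subseteq> univ A"
      proof
        fix u assume "u \<in> range s"
        then obtain v where u: "u = s v" by blast
        show "u \<in> univ A"
        proof (cases "v \<in> set zs")
          case True
          then obtain i where "i < m" "v = zs ! i" using z(2) by (metis in_set_conv_nth)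
          then show ?thesis using u s_zs row by simp
        qed (simp add: u s_def)
      qed
      have rhs: "lin_form M (id_matrix R i) (\<lambda>k. s (zs ! k)) [0..<length zs] = Hc i"
        if "i < m" "rmodule R M" "univ A \<subseteq> univ M" for M :: "('r, 'u) struct" and i
      proof -
        interpret M: rmodule R M by (rule that)
        have sM: "s v \<in> univ M" for v using s_A that(3) by auto
        have "lin_form M (id_matrix R i) (\<lambda>k. s (zs ! k)) [0..<length zs]
            = (if i \<in> set [0..<length zs] then s (zs ! i) else zeroM M)"
          by (rule M.lin_form_id_matrix[OF R]) (simp_all only: distinct_upt sM)
        then show ?thesis using that(1) s_zs z(2) by simp
      qed
      have AsubC: "univ A \<subseteq> univ C" and AsubB: "univ A \<subseteq> univ B"
        using AC AB by (auto simp: formula_le_def submodule_le_def substructure_def)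
      have "sat (pp_form m H (id_matrix R) ys' zs) C s"
        unfolding sat_pp_form[OF z(3)]
        by (rule exI[of _ c]) (use rhs[OF _ C.rmodule_axioms AsubC] bc(2) z(1) Hc_def in auto)
      then have "sat (pp_form m H (id_matrix R) ys' zs) A s"
        using AC z(4) s_A by (auto simp: formula_le_def)
      then obtain e where e: "\<forall>j<length ys. e j \<in> univ A"
        "\<forall>i<m. lin_form A (H i) e [0..<length ys] = Hc i"
        unfolding sat_pp_form[OF z(3)] using rhs[OF _ A.rmodule_axioms] z(1) by auto
      have "sat (pp_form m H K ys xs) B a'"
        unfolding sat_pp_form[OF dis]
      proof (intro exI[of _ "\<lambda>j. addM B (b j) (e j)"] conjI allI impI)
        fix j assume "j < length ys"
        then show "addM B (b j) (e j) \<in> univ B" using bc e AsubB by auto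
      next
        fix i assume i: "i < m"
        have "lin_form B (H i) (\<lambda>j. addM B (b j) (e j)) [0..<length ys]
            = addM B (Hb i) (lin_form B (H i) e [0..<length ys])"
          unfolding Hb_def by (rule B.lin_form_add) (use H i bc e AsubB in auto)
        also have "lin_form B (H i) e [0..<length ys] = Hc i"
          using lin_form_hom[OF mods(1) substructure_hom[OF AB], of "[0..<length ys]" "H i" e]
            H i e by auto
        also have "addM B (Hb i) (Hc i) = Ka i"
          using row[OF i, THEN conjunct1, symmetric] cl[OF i]
          by (simp add: B.add_commute[of "Ka i"])
        finally show "lin_form B (H i) (\<lambda>j. addM B (b j) (e j)) [0..<length ys] =
            lin_form B (K i) (\<lambda>k. a' (xs ! k)) [0..<length xs]" by (simp add: Ka_def)
      qed
      then have "sat \<phi> E (\<lambda>v. f (a' v))"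
        unfolding \<phi>_eq by (rule sat_pp_form_hom[OF mods(2) fE d a'(1)])
      moreover have "(\<lambda>v. f (a' v)) = a" using a'(2) by auto
      ultimately show "sat \<phi> E a" by simp
    qed
  qed
  ultimately show ?thesis unfolding formula_le_def E_def by blast
qed

subsection \<open>Pushouts\<close>

definition prod_struct :: "'r ring \<Rightarrow> ('r, 'a) struct \<Rightarrow> ('r, 'b) struct \<Rightarrow> ('r, 'a \<times> 'b) struct" where
  "prod_struct R B C =
     \<lparr>univ = univ B \<times> univ C, zeroM = (zeroM B, zeroM C),
      addM = (\<lambda>p p'. if p \<in> univ B \<times> univ C \<and> p' \<in> univ B \<times> univ C
                      then (addM B (fst p) (fst p'), addM C (snd p) (snd p')) else undefined),
      negM = (\<lambda>p. if p \<in> univ B \<times> univ C then (negM B (fst p), negM C (snd p)) else undefined),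
      scalM = (\<lambda>r p. if r \<in> carrier R \<and> p \<in> univ B \<times> univ C
                      then (scalM B r (fst p), scalM C r (snd p)) else undefined)\<rparr>"

lemma left_module_prod:
  assumes R: "ring R" and "left_module R B" "left_module R C"
  shows "left_module R (prod_struct R B C)"
proof -
  interpret ring R by (rule R)
  interpret B: rmodule R B by standard fact
  interpret C: rmodule R C by standard fact
  have tau: "tau_structure R (prod_struct R B C)"
    by (auto simp: tau_structure_def prod_struct_def)
  show ?thesis
    by (rule left_moduleI[OF tau])
       (auto simp: prod_struct_def B.add_ac C.add_ac B.scal_add C.scal_add
          B.add_scal C.add_scal B.scal_scal C.scal_scal)
qed

text \<open>
  Slicing along the first factor turns the product into a small union of small sets, to which the
  regularity clause of inaccessibility applies.
\<close>

lemma small_image_times: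
  fixes X Y :: "'u set" and q :: "'u \<times> 'u \<Rightarrow> 'u"
  assumes inac: "inaccessible (UNIV :: 'u set)" and X: "small X" and Y: "small Y"
  shows "small (q ` (X \<times> Y))"
proof -
  have "(\<Union>x\<in>X. q ` ({x} \<times> Y)) \<prec> (UNIV :: 'u set)"
  proof -
    have "q ` ({x} \<times> Y) \<prec> (UNIV :: 'u set)" for x
    proof -
      have "q ` ({x} \<times> Y) = (\<lambda>y. q (x, y)) ` Y" by auto
      then have "q ` ({x} \<times> Y) \<lesssim> Y" by (simp add: image_lepoll)
      then show ?thesis using Y lesspoll_trans1 unfolding small_def by blast
    qed
    then show ?thesis using inac X unfolding inaccessible_def small_def by simp
  qed
  moreover have "(\<Union>x\<in>X. q ` ({x} \<times> Y)) = q ` (X \<times> Y)" by auto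
  ultimately show ?thesis by (simp add: small_def)
qed

lemma infinite_universe: "inaccessible (UNIV :: 'u set) \<Longrightarrow> infinite (UNIV :: 'u set)"
  by (simp add: inaccessible_def infinite_le_lepoll lesspoll_imp_lepoll)

text \<open>
  The pushout is the quotient of \<open>B \<times> C\<close> by the antidiagonal copy of \<open>A\<close>.
\<close>

lemma pushout_exists:
  fixes A B C :: "('r, 'u) struct"
  assumes inac: "inaccessible (UNIV :: 'u set)" and R: "ring R"
    and AB: "submodule_le R A B" and AC: "submodule_le R A C"
  obtains D :: "('r, 'u) struct" and f g where
    "D \<in> R_Mod R" "mod_hom R f B D" "mod_hom R g C D"
    "\<And>d. d \<in> univ D \<Longrightarrow> \<exists>b\<in>univ B. \<exists>c\<in>univ C. d = addM D (f b) (g c)"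
    "\<And>b c. b \<in> univ B \<Longrightarrow> c \<in> univ C \<Longrightarrow> f b = g c \<longleftrightarrow> b = c \<and> b \<in> univ A"
proof -
  have mods: "left_module R A" "left_module R B" "left_module R C"
    and sB: "substructure R A B" and sC: "substructure R A C"
    and small: "small (univ B)" "small (univ C)"
    using AB AC by (auto simp: R_Mod_def submodule_le_def)
  interpret A: rmodule R A by standard (rule mods)
  interpret B: rmodule R B by standard (rule mods)
  interpret C: rmodule R C by standard (rule mods)
  define X where "X = prod_struct R B C"
  have X: "left_module R X" unfolding X_def by (rule left_module_prod[OF R mods(2,3)])
  define N where "N = (\<lambda>a. (a, negM A a)) ` univ A"
  have N: "is_submodule R N X"
  proof -
    have h: "\<And>x. x \<in> univ A \<Longrightarrow> x \<in> univ B" "\<And>x. x \<in> univ A \<Longrightarrow> x \<in> univ C"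
      "zeroM B = zeroM A" "zeroM C = zeroM A"
      "\<And>x y. x \<in> univ A \<Longrightarrow> y \<in> univ A \<Longrightarrow> addM B x y = addM A x y"
      "\<And>x y. x \<in> univ A \<Longrightarrow> y \<in> univ A \<Longrightarrow> addM C x y = addM A x y"
      "\<And>x. x \<in> univ A \<Longrightarrow> negM B x = negM A x"
      "\<And>x. x \<in> univ A \<Longrightarrow> negM C x = negM A x"
      "\<And>r x. x \<in> univ A \<Longrightarrow> r \<in> carrier R \<Longrightarrow> scalM B r x = scalM A r x"
      "\<And>r x. x \<in> univ A \<Longrightarrow> r \<in> carrier R \<Longrightarrow> scalM C r x = scalM A r x"
      using sB sC by (auto simp: substructure_def)
    show ?thesis
      unfolding is_submodule_def N_def X_def prod_struct_def
      by (auto simp: h image_iff A.neg_add A.scal_neg)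
  qed
  obtain \<iota> :: "'u \<times> 'u \<Rightarrow> 'u" where \<iota>: "inj \<iota>"
  proof -
    have "(UNIV \<times> UNIV :: ('u \<times> 'u) set) \<approx> (UNIV :: 'u set)"
      unfolding eqpoll_iff_card_of_ordIso
      by (rule card_of_Times_same_infinite[OF infinite_universe[OF inac]])
    then show ?thesis using that by (auto simp: eqpoll_def bij_betw_def)
  qed
  have "inj_on \<iota> (univ X)" using \<iota> inj_on_subset by blast
  then obtain q and D :: "('r, 'u) struct" where D: "left_module R D" and q: "mod_hom R q X D"
    and uD: "univ D = q ` univ X"
    and ker: "\<And>x y. x \<in> univ X \<Longrightarrow> y \<in> univ X \<Longrightarrow> q x = q y \<longleftrightarrow> addM X x (negM X y) \<in> N"
    using quotient_module_exists[OF R X N] by metis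
  have uX: "univ X = univ B \<times> univ C" by (simp add: X_def prod_struct_def)
  have hq: "\<And>b c b' c'. b \<in> univ B \<Longrightarrow> c \<in> univ C \<Longrightarrow> b' \<in> univ B \<Longrightarrow> c' \<in> univ C \<Longrightarrow>
        addM D (q (b, c)) (q (b', c')) = q (addM B b b', addM C c c')"
      "\<And>b c. b \<in> univ B \<Longrightarrow> c \<in> univ C \<Longrightarrow> negM D (q (b, c)) = q (negM B b, negM C c)"
      "\<And>r b c. r \<in> carrier R \<Longrightarrow> b \<in> univ B \<Longrightarrow> c \<in> univ C \<Longrightarrow>
        scalM D r (q (b, c)) = q (scalM B r b, scalM C r c)"
      "zeroM D = q (zeroM B, zeroM C)"
      "\<And>b c. b \<in> univ B \<Longrightarrow> c \<in> univ C \<Longrightarrow> q (b, c) \<in> univ D"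
    using q by (auto simp: mod_hom_def X_def prod_struct_def)
  define f where "f b = q (b, zeroM C)" for b
  define g where "g c = q (zeroM B, c)" for c
  show ?thesis
  proof (rule that[of D f g])
    show "D \<in> R_Mod R"
      using D small_image_times[OF inac small, of q] by (simp add: R_Mod_def uD uX)
    show "mod_hom R f B D"
      by (auto simp: mod_hom_def f_def hq)
    show "mod_hom R g C D"
      by (auto simp: mod_hom_def g_def hq)
    show "\<exists>b\<in>univ B. \<exists>c\<in>univ C. d = addM D (f b) (g c)" if d: "d \<in> univ D" for d
    proof -
      obtain b c where bc: "b \<in> univ B" "c \<in> univ C" "d = q (b, c)" using d uD uX by auto
      have "addM D (f b) (g c) = d"
        using bc by (simp add: f_def g_def hq)
      then show ?thesis using bc by blast
    qed
    show "f b = g c \<longleftrightarrow> b = c \<and> b \<in> univ A" if "b \<in> univ B" "c \<in> univ C" for b c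
    proof -
      have "f b = g c \<longleftrightarrow> addM X (b, zeroM C) (negM X (zeroM B, c)) \<in> N"
        using ker that uX by (simp add: f_def g_def)
      also have "addM X (b, zeroM C) (negM X (zeroM B, c)) = (b, negM C c)"
        using that by (simp add: X_def prod_struct_def)
      also have "(b, negM C c) \<in> N \<longleftrightarrow> b \<in> univ A \<and> negM C c = negM A b"
        by (auto simp: N_def)
      also have "\<dots> \<longleftrightarrow> b = c \<and> b \<in> univ A"
        using that sC by (metis C.neg_neg substructure_def subsetD)
      finally show ?thesis .
    qed
  qed
qed

lemma strong_embedding_onto_image:
  assumes "left_module R X" "left_module R Y" "mod_hom R f X Y" "inj_on f (univ X)"
    "prec (restrict_struct R (f ` univ X) Y) Y"
  shows "strong_embedding R prec f X Y"
proof -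
  have "is_submodule R (f ` univ X) Y"
    by (intro is_submodule_image[OF assms(1,3)] is_submodule_univ assms(1))
  then have "substructure R (restrict_struct R (f ` univ X) Y) Y"
    using assms(2) by (intro substructure_restrict) (simp_all add: left_module_def)
  then show ?thesis
    unfolding strong_embedding_def using iso_onto_image[OF assms(1-4)] assms(5) by blast
qed

text \<open>
  The amalgam is the pushout: each of its two legs is strong because the opposite side
  of the span is.
\<close>

theorem pleasant_amalgamation:
  fixes R :: "'r ring" and prec :: "('r, 'u) struct \<Rightarrow> ('r, 'u) struct \<Rightarrow> bool"
  assumes inac: "inaccessible (UNIV :: 'u set)" and R: "ring R" and pl: "pleasant R prec"
  shows "amalgamation_property R (R_Mod R) prec"
  unfolding amalgamation_property_def
proof (intro ballI impI)
  fix A B C :: "('r, 'u) struct"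
  assume K: "A \<in> R_Mod R" "B \<in> R_Mod R" "C \<in> R_Mod R" and le: "prec A B \<and> prec A C"
  obtain \<Sigma> where \<Sigma>: "pleasant_set R \<Sigma>" and prec: "prec = formula_le R \<Sigma>"
    using pl unfolding pleasant_def by blast
  have sub: "submodule_le R A B" "submodule_le R A C"
    using le prec by (auto simp: formula_le_def)
  have subs: "substructure R A B" "substructure R A C"
    using sub by (auto simp: submodule_le_def)
  obtain D :: "('r, 'u) struct" and f g where D: "D \<in> R_Mod R"
    and f: "mod_hom R f B D" and g: "mod_hom R g C D"
    and cover: "\<And>d. d \<in> univ D \<Longrightarrow> \<exists>b\<in>univ B. \<exists>c\<in>univ C. d = addM D (f b) (g c)"
    and glue: "\<And>b c. b \<in> univ B \<Longrightarrow> c \<in> univ C \<Longrightarrow> f b = g c \<longleftrightarrow> b = c \<and> b \<in> univ A"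
    by (rule pushout_exists[OF inac R sub], rule that)
  have mods: "left_module R B" "left_module R C" "left_module R D"
    using K D by (auto simp: R_Mod_def)
  interpret B: rmodule R B by standard (rule mods)
  interpret C: rmodule R C by standard (rule mods)
  interpret D: rmodule R D by standard (rule mods)
  have cover': "\<exists>c\<in>univ C. \<exists>b\<in>univ B. d = addM D (g c) (f b)" if d: "d \<in> univ D" for d
  proof -
    obtain b c where bc: "b \<in> univ B" "c \<in> univ C" "d = addM D (f b) (g c)"
      using cover[OF d] by blast
    have "f b \<in> univ D" "g c \<in> univ D" using f g bc by (auto simp: mod_hom_def)
    then show ?thesis using bc D.add_commute by blast
  qed
  have prec_f: "prec (restrict_struct R (f ` univ B) D) D"
    unfolding prec
  proof (rule pushout_leg_formula_le[OF R K(2) D \<Sigma> _ subs(1) f g cover])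
    show "formula_le R \<Sigma> A C" using le prec by simp
    show "b = c \<and> b \<in> univ A" if "b \<in> univ B" "c \<in> univ C" "f b = g c" for b c
      using glue[OF that(1,2)] that(3) by metis
  qed
  have prec_g: "prec (restrict_struct R (g ` univ C) D) D"
    unfolding prec
  proof (rule pushout_leg_formula_le[OF R K(3) D \<Sigma> _ subs(2) g f cover'])
    show "formula_le R \<Sigma> A B" using le prec by simp
    show "c = b \<and> c \<in> univ A" if "c \<in> univ C" "b \<in> univ B" "g c = f b" for c b
      using glue[OF that(2,1)] that(3) by metis
  qed
  have inj_kernel: "inj_on h (univ Y)"
    if "rmodule R Y" "mod_hom R h Y D" "\<And>y. y \<in> univ Y \<Longrightarrow> h y = zeroM D \<Longrightarrow> y = zeroM Y"
    for h and Y :: "('r, 'u) struct"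
  proof (rule inj_onI)
    interpret Y: rmodule R Y by (rule that)
    fix x y assume xy: "x \<in> univ Y" "y \<in> univ Y" "h x = h y"
    have "h y \<in> univ D" "h (addM Y x (negM Y y)) = addM D (h x) (negM D (h y))"
      using that(2) xy(1,2) Y.neg_closed[OF xy(2)] unfolding mod_hom_def by auto
    then have "h (addM Y x (negM Y y)) = zeroM D" using xy(3) by simp
    then have "addM Y x (negM Y y) = zeroM Y" using that(3) xy(1,2) by simp
    then show "x = y" using Y.diff_eq_zero xy(1,2) by simp
  qed
  have inj_f: "inj_on f (univ B)"
  proof (rule inj_kernel[OF B.rmodule_axioms f])
    fix b assume b: "b \<in> univ B" "f b = zeroM D"
    then have "f b = g (zeroM C)" using g by (simp add: mod_hom_def)
    then show "b = zeroM B" using glue[OF b(1) C.zero_closed] subs by (simp add: substructure_def)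
  qed
  have inj_g: "inj_on g (univ C)"
  proof (rule inj_kernel[OF C.rmodule_axioms g])
    fix c assume c: "c \<in> univ C" "g c = zeroM D"
    then have "f (zeroM B) = g c" using f by (simp add: mod_hom_def)
    then show "c = zeroM C" using glue[OF B.zero_closed c(1)] subs by (simp add: substructure_def)
  qed
  have agree: "\<forall>x\<in>univ A. f x = g x"
  proof
    fix x assume x: "x \<in> univ A"
    then have "x \<in> univ B" "x \<in> univ C" using subs by (auto simp: substructure_def)
    then show "f x = g x" using glue x by blast
  qed
  show "\<exists>D\<in>R_Mod R. \<exists>f g. strong_embedding R prec f B D \<and>
      strong_embedding R prec g C D \<and> (\<forall>x\<in>univ A. f x = g x)"
    by (intro bexI[OF _ D] exI[of _ f] exI[of _ g] conjI
        strong_embedding_onto_image[where prec=prec, OF mods(1,3) f inj_f prec_f]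
        strong_embedding_onto_image[where prec=prec, OF mods(2,3) g inj_g prec_g] agree)
qed

section \<open>Countable chains in an abstract elementary class\<close>

lemma countable_imp_small:
  fixes S :: "'u set"
  assumes "inaccessible (UNIV :: 'u set)" "countable S"
  shows "small S"
proof -
  have "S \<lesssim> (UNIV :: nat set)" using assms(2) by (auto simp: countable_def lepoll_def)
  moreover have "(UNIV :: nat set) \<prec> (UNIV :: 'u set)" using assms(1) by (simp add: inaccessible_def)
  ultimately show ?thesis unfolding small_def by (rule lesspoll_trans1)
qed

lemma ord_less_linear_order:
  fixes \<alpha> \<beta> \<gamma> :: 'u
  shows "\<not> ord_less \<alpha> \<alpha>"
    and "ord_less \<alpha> \<beta> \<Longrightarrow> ord_less \<beta> \<gamma> \<Longrightarrow> ord_less \<alpha> \<gamma>"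
    and "ord_less \<alpha> \<beta> \<or> \<alpha> = \<beta> \<or> ord_less \<beta> \<alpha>"
proof -
  have wo: "well_order_on (UNIV :: 'u set) (card_of (UNIV :: 'u set))"
    by (rule card_of_well_order_on)
  then have lo: "linear_order_on (UNIV :: 'u set) (card_of (UNIV :: 'u set))"
    by (simp add: well_order_on_def)
  then have tr: "trans (card_of (UNIV :: 'u set))" and an: "antisym (card_of (UNIV :: 'u set))"
    and to: "total_on UNIV (card_of (UNIV :: 'u set))"
    by (auto simp: order_on_defs)
  show "\<not> ord_less \<alpha> \<alpha>" by (simp add: ord_less_def)
  show "ord_less \<alpha> \<beta> \<Longrightarrow> ord_less \<beta> \<gamma> \<Longrightarrow> ord_less \<alpha> \<gamma>"
    unfolding ord_less_def using transD[OF tr, of \<alpha> \<beta> \<gamma>] antisymD[OF an, of \<alpha> \<beta>] by auto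
  show "ord_less \<alpha> \<beta> \<or> \<alpha> = \<beta> \<or> ord_less \<beta> \<alpha>"
    unfolding ord_less_def using to by (auto simp: total_on_def)
qed

lemma ord_least_exists:
  fixes P :: "'u \<Rightarrow> bool"
  assumes "P \<alpha>"
  obtains \<mu> where "P \<mu>" "\<And>\<beta>. ord_less \<beta> \<mu> \<Longrightarrow> \<not> P \<beta>"
proof -
  have "wf (card_of (UNIV :: 'u set) - Id)"
    using card_of_well_order_on[of "UNIV :: 'u set"] by (simp add: well_order_on_def)
  then obtain \<mu> where \<mu>: "P \<mu>" "\<And>\<beta>. (\<beta>, \<mu>) \<in> card_of (UNIV :: 'u set) - Id \<Longrightarrow> \<not> P \<beta>"
    using assms wfE_min[of _ \<alpha> "Collect P"] by (metis mem_Collect_eq)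
  show ?thesis by (rule that[OF \<mu>(1)]) (use \<mu>(2) in \<open>auto simp: ord_less_def\<close>)
qed

text \<open>
  Ordinals being elements of the universe, \<open>\<omega>\<close> has to be found there.  Iterating successors from
  the least element gives a countable, hence proper, initial segment of the well-order, and \<open>\<omega>\<close> is
  the first element beyond it.  No finite ordinal is a limit, which makes continuity of a chain
  of length \<open>\<omega>\<close> vacuous.
\<close>

lemma omega_exists:
  assumes inac: "inaccessible (UNIV :: 'u set)"
  obtains on :: "nat \<Rightarrow> 'u" and \<omega> :: 'u where
    "seg \<omega> = range on" "ord_limit \<omega>" "\<And>m n. ord_less (on m) (on n) \<longleftrightarrow> m < n"
    "\<And>n. \<not> ord_limit (on n)"
proof -
  note lin = ord_less_linear_order
  have ex_gt: "\<exists>\<beta>. ord_less \<alpha> \<beta>" for \<alpha> :: 'u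
    using infinite_Card_order_limit[OF card_of_Card_order, of "UNIV :: 'u set" \<alpha>]
      infinite_universe[OF inac] by (auto simp: Field_card_of ord_less_def)
  have "\<exists>\<beta>. ord_succ \<alpha> \<beta>" for \<alpha> :: 'u
  proof -
    obtain \<beta> where "ord_less \<alpha> \<beta>" "\<And>\<gamma>. ord_less \<gamma> \<beta> \<Longrightarrow> \<not> ord_less \<alpha> \<gamma>"
      using ex_gt[of \<alpha>] ord_least_exists[of "ord_less \<alpha>"] by metis
    then show ?thesis unfolding ord_succ_def by blast
  qed
  then obtain s :: "'u \<Rightarrow> 'u" where s: "\<And>\<alpha>. ord_succ \<alpha> (s \<alpha>)" by metis
  obtain z :: 'u where z: "\<And>\<beta>. \<not> ord_less \<beta> z"
    using ord_least_exists[of "\<lambda>_. True"] by metis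
  define on where "on = rec_nat z (\<lambda>_. s)"
  have on: "on 0 = z" "\<And>n. on (Suc n) = s (on n)" by (simp_all add: on_def)
  have step: "ord_less (on n) (on (Suc n))" for n using s on by (simp add: ord_succ_def)
  have mono: "ord_less (on m) (on n)" if "m < n" for m n
    using that
  proof (induction n)
    case (Suc n)
    then show ?case using step[of n] lin(2)[of "on m" "on n" "on (Suc n)"] by (auto simp: less_Suc_eq)
  qed simp
  have iff: "ord_less (on m) (on n) \<longleftrightarrow> m < n" for m n
    using mono lin(1,2) by (metis linorder_neqE_nat)
  have below: "\<beta> \<in> range on" if "ord_less \<beta> (on n)" for \<beta> n
    using that
  proof (induction n)
    case (Suc n)
    have "\<not> ord_less (on n) \<beta>" using s[of "on n"] Suc.prems on by (auto simp: ord_succ_def)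
    then show ?case using Suc.IH lin(3)[of \<beta> "on n"] by auto
  qed (use z on in simp)
  have "range on \<noteq> UNIV"
    using countable_imp_small[OF inac, of "range on"] by (auto simp: small_def)
  then obtain \<alpha> where "\<alpha> \<notin> range on" by blast
  then obtain \<omega> where \<omega>: "\<omega> \<notin> range on" "\<And>\<beta>. ord_less \<beta> \<omega> \<Longrightarrow> \<beta> \<in> range on"
    using ord_least_exists[of "\<lambda>\<alpha>. \<alpha> \<notin> range on"] by metis
  have above: "ord_less (on n) \<omega>" for n
    using \<omega>(1) below lin(3)[of "on n" \<omega>] by blast
  have seg: "seg \<omega> = range on" using above \<omega>(2) by (auto simp: seg_def)
  have "\<not> ord_succ \<beta> \<omega>" for \<beta>
  proof
    assume \<beta>: "ord_succ \<beta> \<omega>"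
    then obtain n where "\<beta> = on n" using \<omega>(2) by (auto simp: ord_succ_def)
    then show False using \<beta> step above by (auto simp: ord_succ_def)
  qed
  then have lim: "ord_limit \<omega>" using seg by (auto simp: ord_limit_def ord_zero_def)
  have "\<not> ord_limit (on n)" for n
  proof (cases n)
    case 0
    then show ?thesis using z on by (simp add: ord_limit_def ord_zero_def seg_def)
  next
    case (Suc k)
    then show ?thesis using s on by (auto simp: ord_limit_def)
  qed
  then show ?thesis by (rule that[OF seg lim iff])
qed

text \<open>
  Coherence turns a chain of strong substructures of a common \<open>B\<close> into a chain for the relation
  itself.  This is the only source of strong substructures that are not direct summands.
\<close>

lemma AEC_countable_chain_union:
  fixes B U :: "('r, 'u) struct" and S :: "nat \<Rightarrow> ('r, 'u) struct"
  assumes inac: "inaccessible (UNIV :: 'u set)" and aec: "AEC R K prec"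
    and below: "\<And>n. prec (S n) B"
    and chain: "\<And>m n. m < n \<Longrightarrow> substructure R (S m) (S n)"
    and U: "univ U = (\<Union>n. univ (S n))" "\<And>n. substructure R (S n) U"
  shows "prec U B"
proof -
  obtain on :: "nat \<Rightarrow> 'u" and \<omega> :: 'u where seg: "seg \<omega> = range on" and lim: "ord_limit \<omega>"
    and less: "\<And>m n. ord_less (on m) (on n) \<longleftrightarrow> m < n" and nolim: "\<And>n. \<not> ord_limit (on n)"
 by (rule omega_exists[OF inac]) (rule that)
  have "inj on" using less by (metis injI linorder_neqE_nat less_irrefl)
  define A where "A = (\<lambda>i. S (inv_into UNIV on i))"
  have A: "A (on n) = S n" for n using \<open>inj on\<close> by (simp add: A_def)
  have "\<forall>A B. prec A B \<longrightarrow> A \<in> K \<and> B \<in> K"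
    using aec unfolding AEC_def by (elim conjE) assumption
  then have K: "B \<in> K" "S n \<in> K" for n using below by blast+
  have "\<forall>A B C. prec A C \<and> prec B C \<and> substructure R A B \<longrightarrow> prec A B"
    using aec unfolding AEC_def by (elim conjE) assumption
  then have coh: "prec (S m) (S n)" if "m < n" for m n using below chain[OF that] by blast
  have "continuous_chain R prec \<omega> A"
    using coh nolim by (auto simp: continuous_chain_def seg A less)
  moreover have "is_union R (seg \<omega>) A U" using U by (auto simp: is_union_def seg A)
  moreover have "\<forall>i\<in>seg \<omega>. A i \<in> K" "\<forall>i\<in>seg \<omega>. prec (A i) B" using K below by (auto simp: seg A)
  moreover have "\<forall>\<delta> A U. ord_limit \<delta> \<and> (\<forall>i\<in>seg \<delta>. A i \<in> K) \<and> continuous_chain R prec \<delta> A \<and>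
              is_union R (seg \<delta>) A U \<longrightarrow>
        U \<in> K \<and> (\<forall>j\<in>seg \<delta>. prec (A j) U) \<and>
        (\<forall>B\<in>K. (\<forall>i\<in>seg \<delta>. prec (A i) B) \<longrightarrow> prec U B)"
    using aec unfolding AEC_def by (elim conjE) assumption
  ultimately show ?thesis using lim K(1) by blast
qed

section \<open>Direct summands of quotients\<close>

text \<open>
  A decomposition that holds upstairs up to the kernel \<open>N\<close> becomes a direct sum in the quotient.
\<close>

lemma quotient_summand:
  fixes X :: "('r, 'a) struct" and Y :: "('r, 'u) struct"
  assumes R: "ring R" and X: "left_module R X" and Y: "left_module R Y" and q: "mod_hom R q X Y"
    and ker: "\<And>x y. x \<in> univ X \<Longrightarrow> y \<in> univ X \<Longrightarrow> q x = q y \<longleftrightarrow> addM X x (negM X y) \<in> N"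
    and sub: "is_submodule R S X" "is_submodule R T X" "is_submodule R E X"
    and le: "N \<subseteq> S" "S \<subseteq> T" "E \<subseteq> T" and disj: "S \<inter> E \<subseteq> N"
    and dec: "\<And>x. x \<in> T \<Longrightarrow> \<exists>s\<in>S. \<exists>e\<in>E. x = addM X s e"
    and small: "small (q ` T)"
  shows "summand_le R (restrict_struct R (q ` S) Y) (restrict_struct R (q ` T) Y)"
proof -
  interpret X: rmodule R X by standard (rule X)
  interpret Y: rmodule R Y by standard (rule Y)
  have sub': "is_submodule R (q ` S) Y" "is_submodule R (q ` T) Y" "is_submodule R (q ` E) Y"
    using is_submodule_image[OF X q] sub by auto
  have inX: "\<And>x. x \<in> T \<Longrightarrow> x \<in> univ X" using sub(2) by (auto simp: is_submodule_def)
  have sm: "small (q ` Z)" if "Z \<subseteq> T" for Z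
    using small subset_imp_lepoll[OF image_mono[OF that, of q]] lesspoll_trans1
    unfolding small_def by blast
  have le_sub: "submodule_le R (restrict_struct R (q ` Z) Y) (restrict_struct R (q ` T) Y)"
    if "Z \<subseteq> T" "is_submodule R (q ` Z) Y" for Z
    using that sub'(2) small sm[OF that(1)]
    by (auto simp: submodule_le_def R_Mod_def left_module_restrict[OF R Y]
        intro!: substructure_restrict_restrict)
  have q0: "q (zeroM X) = zeroM Y" using q by (simp add: mod_hom_def)
  have z: "zeroM X \<in> S" "zeroM X \<in> E" using sub by (auto simp: is_submodule_def)
  have int: "u = zeroM Y" if u: "u \<in> q ` S" "u \<in> q ` E" for u
  proof -
    obtain s e where se: "s \<in> S" "e \<in> E" "u = q s" "u = q e"
      using u by (elim imageE) blast
    have inU: "s \<in> univ X" "e \<in> univ X" using se inX le by auto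
    have "addM X s (negM X e) \<in> S" using ker[OF inU] se le by auto
    then have "addM X (negM X (addM X s (negM X e))) s \<in> S"
      using sub(1) se(1) by (auto simp: is_submodule_def)
    also have "addM X (negM X (addM X s (negM X e))) s = e"
      using inU by (simp add: X.neg_add X.add_commute[of _ s])
    finally have "addM X e (negM X (zeroM X)) \<in> N" using disj se(2) inU by auto
    then show ?thesis using ker[of e "zeroM X"] inU q0 se(4) by simp
  qed
  have cap: "q ` S \<inter> q ` E = {zeroM Y}"
  proof
    show "q ` S \<inter> q ` E \<subseteq> {zeroM Y}" using int by blast
    have "zeroM Y \<in> q ` S" "zeroM Y \<in> q ` E"
      using z q0 by (metis image_eqI)+
    then show "{zeroM Y} \<subseteq> q ` S \<inter> q ` E" by blast
  qed
  have sum: "\<exists>a\<in>q ` S. \<exists>c\<in>q ` E. b = addM (restrict_struct R (q ` T) Y) a c" if b: "b \<in> q ` T" for b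
  proof -
    obtain x where x: "x \<in> T" "b = q x" using b by blast
    obtain s e where se: "s \<in> S" "e \<in> E" "x = addM X s e" using dec[OF x(1)] by blast
    have inT: "s \<in> T" "e \<in> T" using se le by auto
    have "b = addM Y (q s) (q e)"
      using x(2) se(3) q inX[OF inT(1)] inX[OF inT(2)] by (simp add: mod_hom_def)
    then have "b = addM (restrict_struct R (q ` T) Y) (q s) (q e)"
      using inT by (simp add: restrict_struct_def)
    then show ?thesis using se(1,2) by blast
  qed
  have zT: "zeroM (restrict_struct R (q ` T) Y) = zeroM Y" by (simp add: restrict_struct_def)
  show ?thesis
    unfolding summand_le_def
    using le_sub[OF le(2) sub'(1)] le_sub[OF le(3) sub'(3)] cap sum
    by (intro conjI exI[of _ "restrict_struct R (q ` E) Y"]) (simp_all add: zT)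
qed

section \<open>Divisible halves\<close>

text \<open>
  The matrices of the system \<open>0 = x - 2 y\<close>, \<open>2\<^sup>n z = y\<close> in the unknown \<open>z\<close> with parameters
  \<open>x\<close> and \<open>y\<close>.
\<close>

definition half_rhs :: "nat \<Rightarrow> nat \<Rightarrow> int" where
  "half_rhs i k = (if i = 0 then (if k = 0 then 1 else - 2) else (if k = 0 then 0 else 1))"

definition half_lhs :: "nat \<Rightarrow> nat \<Rightarrow> nat \<Rightarrow> int" where
  "half_lhs n i j = (if i = 0 then 0 else 2 ^ n)"

text \<open>
  The formula \<open>\<exists>y (2 y = x \<and> y is divisible by all powers of 2)\<close>, that is, \<open>x \<in> 2\<^sup>\<omega>\<^sup>+\<^sup>1 M\<close>.  Putting
  the equation \<open>2 y = x\<close> into every conjunct makes all conjuncts instances of one matrix scheme.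
\<close>

lemma divisible_half_formula:
  assumes inac: "inaccessible (UNIV :: 'u set)"
  obtains \<phi> :: "(int, 'u) fm" where "\<phi> \<in> Lambda_wpp \<Z>"
    "\<And>(M :: (int, 'u) struct) u. left_module \<Z> M \<Longrightarrow> u \<in> univ M \<Longrightarrow> sat \<phi> M (\<lambda>_. u) \<longleftrightarrow>
       (\<exists>y\<in>univ M. scalM M 2 y = u \<and> (\<forall>n::nat. \<exists>z\<in>univ M. scalM M (2 ^ n) z = y))"
proof -
  obtain on :: "nat \<Rightarrow> 'u" and \<omega> :: 'u
    where less: "\<And>m n. ord_less (on m) (on n) \<longleftrightarrow> m < n"
    by (rule omega_exists[OF inac]) (rule that)
  have on: "inj on" using less by (metis injI linorder_neqE_nat less_irrefl)
  define v0 v1 v2 where "v0 = on 0" and "v1 = on 1" and "v2 = on 2"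
  have v: "v0 \<noteq> v1" "v0 \<noteq> v2" "v1 \<noteq> v2" using on by (auto simp: v0_def v1_def v2_def inj_eq)
  define \<psi> where "\<psi> n = pp_form 2 (half_lhs n) half_rhs [v2] [v0, v1]" for n
  define \<phi> where "\<phi> = Ex (set [v1]) (BigAnd (range on) (\<lambda>i. \<psi> (inv_into UNIV on i)))"
  have fo: "fo_pp \<Z> ([v0] @ [v1]) (\<psi> n)" for n
  proof -
    have "pp_data \<Z> 2 (half_lhs n) half_rhs [v2] ([v0] @ [v1])"
      using v by (auto simp: pp_data_def)
    moreover have "first_order \<Z> (\<psi> n)" "free_vars (\<psi> n) \<subseteq> set ([v0] @ [v1])"
      by (auto simp: \<psi>_def pp_form_def row_eq_def numeral_2_eq_2)
    ultimately show ?thesis unfolding fo_pp_def \<psi>_def by auto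
  qed
  have "small (range on)" by (rule countable_imp_small[OF inac]) simp
  then have "\<phi> \<in> Lambda_wpp \<Z>"
    unfolding Lambda_wpp_def \<phi>_def using v fo
    by (intro CollectI exI[of _ "[v0]"] exI[of _ "[v1]"] exI[of _ "range on"]
        exI[of _ "\<lambda>i. \<psi> (inv_into UNIV on i)"]) auto
  moreover have "sat \<phi> M (\<lambda>_. u) \<longleftrightarrow>
      (\<exists>y\<in>univ M. scalM M 2 y = u \<and> (\<forall>n::nat. \<exists>z\<in>univ M. scalM M (2 ^ n) z = y))"
    if M: "left_module \<Z> M" and u: "u \<in> univ M" for M :: "(int, 'u) struct" and u
  proof -
    interpret M: rmodule \<Z> M by standard (rule M)
    have one: "scalM M 1 x = x" if "x \<in> univ M" for x using M.one_scal[OF that] by simp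
    have zero: "scalM M 0 x = zeroM M" if "x \<in> univ M" for x
      using M.zero_scal[OF _ that] int.ring_axioms by simp
    have cl: "scalM M k x \<in> univ M" if "x \<in> univ M" for k x using that by simp
    have neg2: "scalM M (- 2) x = negM M (scalM M 2 x)" if x: "x \<in> univ M" for x
    proof -
      have "addM M (scalM M 2 x) (scalM M (- 2) x) = zeroM M"
        using M.add_scal[of 2 "- 2" x] x zero by simp
      then show ?thesis using M.neg_unique[OF cl[OF x] cl[OF x]] by simp
    qed
    have sat_\<psi>: "sat (\<psi> n) M (override_on (\<lambda>_. u) b {v1}) \<longleftrightarrow>
        scalM M 2 (b v1) = u \<and> (\<exists>z\<in>univ M. scalM M (2 ^ n) z = b v1)"
      if b: "b v1 \<in> univ M" for b n
    proof -
      have nth: "override_on (\<lambda>_. u) b {v1} ([v0, v1] ! k) = (if k = 0 then u else b v1)" if "k < 2" for k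
        using that v by (cases k) auto
      have dis: "distinct ([v2] @ [v0, v1])" using v by auto
      have "sat (\<psi> n) M (override_on (\<lambda>_. u) b {v1}) \<longleftrightarrow>
         (\<exists>c :: nat \<Rightarrow> 'u. c 0 \<in> univ M \<and> zeroM M = addM M u (negM M (scalM M 2 (b v1))) \<and>
              scalM M (2 ^ n) (c 0) = b v1)"
        unfolding \<psi>_def sat_pp_form[OF dis]
        using u b v by (auto simp: half_lhs_def half_rhs_def numeral_2_eq_2 less_Suc_eq
            all_conj_distrib one zero cl neg2 cong: conj_cong)
      also have "\<dots> \<longleftrightarrow> zeroM M = addM M u (negM M (scalM M 2 (b v1))) \<and>
           (\<exists>z\<in>univ M. scalM M (2 ^ n) z = b v1)"
      proof
        assume "zeroM M = addM M u (negM M (scalM M 2 (b v1))) \<and>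
           (\<exists>z\<in>univ M. scalM M (2 ^ n) z = b v1)"
        then obtain z where "zeroM M = addM M u (negM M (scalM M 2 (b v1)))"
          "z \<in> univ M" "scalM M (2 ^ n) z = b v1" by blast
        then show "\<exists>c :: nat \<Rightarrow> 'u. c 0 \<in> univ M \<and> zeroM M = addM M u (negM M (scalM M 2 (b v1))) \<and>
              scalM M (2 ^ n) (c 0) = b v1" by (intro exI[of _ "\<lambda>_ :: nat. z"]) simp
      qed blast
      also have "zeroM M = addM M u (negM M (scalM M 2 (b v1))) \<longleftrightarrow> scalM M 2 (b v1) = u"
        using M.diff_eq_zero[OF u cl[OF b, of 2]] by metis
      finally show ?thesis .
    qed
    have "sat \<phi> M (\<lambda>_. u) \<longleftrightarrow>
      (\<exists>b. b v1 \<in> univ M \<and> (\<forall>n. sat (\<psi> n) M (override_on (\<lambda>_. u) b {v1})))"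
      using on by (simp add: \<phi>_def)
    also have "\<dots> \<longleftrightarrow> (\<exists>b. b v1 \<in> univ M \<and> scalM M 2 (b v1) = u \<and>
        (\<forall>n. \<exists>z\<in>univ M. scalM M (2 ^ n) z = b v1))"
      using sat_\<psi> by (metis (no_types, lifting))
    also have "\<dots> \<longleftrightarrow> (\<exists>y\<in>univ M. scalM M 2 y = u \<and> (\<forall>n::nat. \<exists>z\<in>univ M. scalM M (2 ^ n) z = y))"
    proof
      assume "\<exists>y\<in>univ M. scalM M 2 y = u \<and> (\<forall>n::nat. \<exists>z\<in>univ M. scalM M (2 ^ n) z = y)"
      then obtain y where "y \<in> univ M" "scalM M 2 y = u" "\<forall>n::nat. \<exists>z\<in>univ M. scalM M (2 ^ n) z = y"
        by blast
      then show "\<exists>b. b v1 \<in> univ M \<and> scalM M 2 (b v1) = u \<and>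
        (\<forall>n. \<exists>z\<in>univ M. scalM M (2 ^ n) z = b v1)" by (intro exI[of _ "\<lambda>_. y"]) simp
    qed blast
    finally show ?thesis .
  qed
  ultimately show ?thesis by (rule that)
qed

section \<open>A span without amalgam\<close>

text \<open>
  All modules of the counterexample are subquotients of one group.  A triple \<open>(x, y, t)\<close> is read
  modulo the triples with integral coefficients, hence as an element of a direct sum of copies of
  \<open>\<rat>/\<int>\<close>.  Polynomials only serve as finitely supported sequences, on which evaluation at \<open>1\<close> is
  the sum of the coefficients.  With \<open>\<zeta>\<^sub>k\<close> and \<open>c\<^sub>k\<close> for the elements of order \<open>2\<^sup>k\<^sup>+\<^sup>1\<close> at the \<open>k\<close>-th
  place of \<open>x\<close> and of \<open>y\<close>, and \<open>d\<^sub>k\<close> for \<open>t = 1 / 2\<^sup>k\<^sup>+\<^sup>2\<close>, the group \<open>C\<close> is generated by all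
  \<open>\<zeta>\<^sub>k + d\<^sub>k\<close> and \<open>c\<^sub>k\<close>, the group \<open>B\<close> by all \<open>\<zeta>\<^sub>k + d\<^sub>k\<close> and \<open>c\<^sub>k + d\<^sub>k\<close>, and
  \<open>A = B \<inter> C\<close> by all \<open>\<zeta>\<^sub>k + d\<^sub>k\<close> and \<open>c\<^sub>k - 2 c\<^sub>k\<^sub>+\<^sub>1\<close>.  Since
  \<open>2 d\<^sub>k\<close> equals the nonzero coefficient \<open>1 / 2\<^sup>k\<^sup>+\<^sup>1\<close> of \<open>\<zeta>\<^sub>k\<close> and \<open>c\<^sub>k\<close>, the equations \<open>2 t = x(1)\<close> and
  \<open>2 t = x(1) + y(1)\<close> modulo \<open>\<int>\<close> cut out \<open>C\<close> and \<open>B\<close>.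
\<close>

type_synonym triple = "rat poly \<times> rat poly \<times> rat"

definition ambient :: "(int, triple) struct" where
  "ambient = \<lparr>univ = UNIV, zeroM = (0, 0, 0),
     addM = (\<lambda>(x, y, t) (x', y', t'). (x + x', y + y', t + t')),
     negM = (\<lambda>(x, y, t). (- x, - y, - t)),
     scalM = (\<lambda>r (x, y, t). (smult (of_int r) x, smult (of_int r) y, of_int r * t))\<rparr>"

lemma ambient_simps [simp]:
  "univ ambient = UNIV"
  "zeroM ambient = (0, 0, 0)"
  "addM ambient (x, y, t) (x', y', t') = (x + x', y + y', t + t')"
  "negM ambient (x, y, t) = (- x, - y, - t)"
  "scalM ambient r (x, y, t) = (smult (of_int r) x, smult (of_int r) y, of_int r * t)"
  by (simp_all add: ambient_def)

lemma left_module_ambient: "left_module \<Z> ambient"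
  by (rule left_moduleI)
     (auto simp: tau_structure_def smult_add_right smult_add_left algebra_simps)

lemma is_submodule_ambientI:
  assumes "(0, 0, 0) \<in> S"
    and "\<And>x y t x' y' t'. (x, y, t) \<in> S \<Longrightarrow> (x', y', t') \<in> S \<Longrightarrow> (x + x', y + y', t + t') \<in> S"
    and "\<And>r x y t. (x, y, t) \<in> S \<Longrightarrow> (smult (of_int r) x, smult (of_int r) y, of_int r * t) \<in> S"
  shows "is_submodule \<Z> S ambient"
proof -
  have "(- x, - y, - t) \<in> S" if "(x, y, t) \<in> S" for x y t
    using assms(3)[OF that, of "- 1"] by simp
  then show ?thesis using assms by (auto simp: is_submodule_def)
qed

definition integral :: "rat poly \<Rightarrow> bool" where
  "integral p \<longleftrightarrow> (\<forall>k. coeff p k \<in> \<int>)"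

text \<open>
  The \<open>k\<close>-th coefficient has order dividing \<open>2\<^sup>k\<^sup>+\<^sup>1\<close> modulo \<open>\<int>\<close>.
\<close>

definition dyadic :: "rat poly \<Rightarrow> bool" where
  "dyadic p \<longleftrightarrow> (\<forall>k. 2 ^ Suc k * coeff p k \<in> \<int>)"

lemma integral_closed:
  "integral 0" "integral p \<Longrightarrow> integral p' \<Longrightarrow> integral (p + p')"
  "integral p \<Longrightarrow> integral p' \<Longrightarrow> integral (p - p')"
  "integral p \<Longrightarrow> integral (smult (of_int r) p)"
  by (auto simp: integral_def)

lemma dyadic_closed:
  "dyadic 0" "dyadic p \<Longrightarrow> dyadic p' \<Longrightarrow> dyadic (p + p')"
  "dyadic p \<Longrightarrow> dyadic p' \<Longrightarrow> dyadic (p - p')"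
  "dyadic p \<Longrightarrow> dyadic (smult (of_int r) p)"
  by (auto simp: dyadic_def distrib_left right_diff_distrib mult.left_commute[of _ "of_int r"]
        simp del: power_Suc)

lemma integral_imp_dyadic: "integral p \<Longrightarrow> dyadic p"
  by (auto simp: integral_def dyadic_def simp del: power_Suc)

lemma integral_poly_1: "integral p \<Longrightarrow> poly p 1 \<in> \<int>"
  by (auto simp: integral_def poly_altdef)

lemma integral_if_all_but_one:
  assumes "\<And>k. k \<noteq> n \<Longrightarrow> coeff p k \<in> \<int>" and "poly p 1 \<in> \<int>"
  shows "integral p"
proof -
  have "integral (p - monom (coeff p n) n)" using assms(1) by (auto simp: integral_def)
  then have "poly (p - monom (coeff p n) n) 1 \<in> \<int>" by (rule integral_poly_1)
  then have "poly p 1 - coeff p n \<in> \<int>" by (simp add: poly_monom)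
  then have "poly p 1 - (poly p 1 - coeff p n) \<in> \<int>" using assms(2) Ints_diff by blast
  then have "coeff p n \<in> \<int>" by simp
  then show ?thesis using assms(1) unfolding integral_def by metis
qed

definition trivial :: "triple set" where
  "trivial = {(x, y, t). integral x \<and> integral y \<and> t \<in> \<int>}"

definition leg_C :: "triple set" where
  "leg_C = {(x, y, t). dyadic x \<and> dyadic y \<and> 2 * t - poly x 1 \<in> \<int>}"

definition leg_B :: "triple set" where
  "leg_B = {(x, y, t). dyadic x \<and> dyadic y \<and> 2 * t - poly (x + y) 1 \<in> \<int>}"

text \<open>
  The subgroup generated by all \<open>\<zeta>\<^sub>k + d\<^sub>k\<close> and by \<open>c\<^sub>k - 2 c\<^sub>k\<^sub>+\<^sub>1\<close> for \<open>k < n\<close>.  The union over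
  all \<open>n\<close> is \<open>leg_B \<inter> leg_C\<close>.
\<close>

definition base :: "nat \<Rightarrow> triple set" where
  "base n = {(x, y, t). dyadic x \<and> dyadic y \<and> 2 * t - poly x 1 \<in> \<int> \<and> poly y 1 \<in> \<int> \<and>
                       (\<forall>k>n. coeff y k \<in> \<int>)}"

text \<open>
  A complement of \<open>base n\<close> in \<open>leg_C\<close>, generated by the \<open>c\<^sub>k\<close> with \<open>k \<ge> n\<close>.
\<close>

definition compl_C :: "nat \<Rightarrow> triple set" where
  "compl_C n = {(x, y, t). integral x \<and> dyadic y \<and> t \<in> \<int> \<and> (\<forall>k<n. coeff y k \<in> \<int>)}"

text \<open>
  A complement of \<open>base n\<close> in \<open>leg_B\<close>, generated by the \<open>c\<^sub>k - \<zeta>\<^sub>k\<close> with \<open>k \<ge> n\<close>.  The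
  generators \<open>c\<^sub>k + d\<^sub>k\<close> would not do: their orders are too large by a factor of 2, and they
  generate the element \<open>1 / 2\<close> of the third coordinate, which belongs to \<open>base n\<close>.
\<close>

definition compl_B :: "nat \<Rightarrow> triple set" where
  "compl_B n = {(x, y, t). integral (x + y) \<and> dyadic y \<and> t \<in> \<int> \<and> (\<forall>k<n. coeff y k \<in> \<int>)}"

lemma Ints_scaled_diff:
  "a - b \<in> \<int> \<Longrightarrow> a' - b' \<in> \<int> \<Longrightarrow> (a + a') - (b + b') \<in> (\<int> :: rat set)"
  "a - b \<in> \<int> \<Longrightarrow> of_int r * a - of_int r * b \<in> (\<int> :: rat set)"
  using Ints_add[of "a - b" "a' - b'"] Ints_mult[of "of_int r" "a - b"]
  by (simp_all add: algebra_simps)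

lemma submodules:
  "is_submodule \<Z> trivial ambient" "is_submodule \<Z> leg_C ambient" "is_submodule \<Z> leg_B ambient"
  "is_submodule \<Z> (base n) ambient"
  "is_submodule \<Z> (compl_C n) ambient" "is_submodule \<Z> (compl_B n) ambient"
proof -
  have sc: "2 * (of_int r * t) = of_int r * (2 * t)" for r and t :: rat by simp
  have lin: "2 * t + 2 * t' - (a + a') \<in> \<int>" if "2 * t - a \<in> \<int>" "2 * t' - a' \<in> \<int>" for t t' a a' :: rat
    by (rule Ints_scaled_diff(1)[OF that])
  have lin': "2 * (of_int r * t) - of_int r * a \<in> \<int>" if "2 * t - a \<in> \<int>" for r and t a :: rat
    using Ints_scaled_diff(2)[OF that, of r] unfolding sc .
  note cl = integral_closed dyadic_closed
  show "is_submodule \<Z> trivial ambient"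
    by (rule is_submodule_ambientI) (auto simp: trivial_def cl)
  show "is_submodule \<Z> leg_C ambient"
    by (rule is_submodule_ambientI) (auto simp: leg_C_def cl intro: lin lin')
  show "is_submodule \<Z> leg_B ambient"
  proof (rule is_submodule_ambientI)
    show "(x + x', y + y', t + t') \<in> leg_B" if "(x, y, t) \<in> leg_B" "(x', y', t') \<in> leg_B"
      for x y t x' y' t'
      using that lin[of t "poly (x + y) 1" t' "poly (x' + y') 1"]
      by (auto simp: leg_B_def cl algebra_simps)
    show "(smult (of_int r) x, smult (of_int r) y, of_int r * t) \<in> leg_B" if "(x, y, t) \<in> leg_B" for r x y t
      using that lin'[of t "poly (x + y) 1" r] by (auto simp: leg_B_def cl distrib_left)
  qed (simp add: leg_B_def cl)
  show "is_submodule \<Z> (base n) ambient"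
    by (rule is_submodule_ambientI) (auto simp: base_def cl intro: lin lin')
  show "is_submodule \<Z> (compl_C n) ambient"
    by (rule is_submodule_ambientI) (auto simp: compl_C_def cl)
  show "is_submodule \<Z> (compl_B n) ambient"
  proof (rule is_submodule_ambientI)
    show "(x + x', y + y', t + t') \<in> compl_B n"
      if "(x, y, t) \<in> compl_B n" "(x', y', t') \<in> compl_B n" for x y t x' y' t'
      using that integral_closed(2)[of "x + y" "x' + y'"]
      by (auto simp: compl_B_def cl add_ac)
    show "(smult (of_int r) x, smult (of_int r) y, of_int r * t) \<in> compl_B n"
      if "(x, y, t) \<in> compl_B n" for r x y t
      using that integral_closed(4)[of "x + y" r] by (auto simp: compl_B_def cl smult_add_right)
  qed (simp add: compl_B_def cl)
qed

lemma base_le: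
  "trivial \<subseteq> base n" "base n \<subseteq> leg_B" "base n \<subseteq> leg_C" "m \<le> n \<Longrightarrow> base m \<subseteq> base n"
proof -
  show "trivial \<subseteq> base n"
    using integral_imp_dyadic integral_poly_1 by (auto simp: trivial_def base_def integral_def)
  show "base n \<subseteq> leg_B"
  proof
    fix v assume "v \<in> base n"
    then obtain x y t where v: "v = (x, y, t)" "dyadic x" "dyadic y" "2 * t - poly x 1 \<in> \<int>" "poly y 1 \<in> \<int>"
      by (auto simp: base_def)
    then show "v \<in> leg_B" using Ints_diff[OF v(4,5)] by (simp add: leg_B_def algebra_simps)
  qed
  show "base n \<subseteq> leg_C" by (auto simp: base_def leg_C_def)
  show "m \<le> n \<Longrightarrow> base m \<subseteq> base n" by (auto simp: base_def)
qed

lemma compl_le: "compl_C n \<subseteq> leg_C" "compl_B n \<subseteq> leg_B"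
proof -
  show "compl_C n \<subseteq> leg_C"
    using integral_imp_dyadic integral_poly_1 by (auto simp: compl_C_def leg_C_def)
  show "compl_B n \<subseteq> leg_B"
  proof
    fix v assume "v \<in> compl_B n"
    then obtain x y t where v: "v = (x, y, t)" "integral (x + y)" "dyadic y" "t \<in> \<int>"
      by (auto simp: compl_B_def)
    have "dyadic x" using dyadic_closed(3)[OF integral_imp_dyadic[OF v(2)] v(3)] by simp
    then show "v \<in> leg_B" using v integral_poly_1[OF v(2)] by (simp add: leg_B_def)
  qed
qed

text \<open>
  In an element of the intersection all coefficients of \<open>y\<close> except the \<open>n\<close>-th are integral, and
  so is their sum, hence also the \<open>n\<close>-th.
\<close>

lemma base_compl_disjoint: "base n \<inter> compl_C n \<subseteq> trivial" "base n \<inter> compl_B n \<subseteq> trivial"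
proof -
  have int: "integral y" if "(x, y, t) \<in> base n" "\<forall>k<n. coeff y k \<in> \<int>" for x y t
    by (rule integral_if_all_but_one[of n]) (use that in \<open>auto simp: base_def linorder_neq_iff\<close>)
  show "base n \<inter> compl_C n \<subseteq> trivial"
    using int by (auto simp: compl_C_def trivial_def)
  show "base n \<inter> compl_B n \<subseteq> trivial"
  proof
    fix v assume v: "v \<in> base n \<inter> compl_B n"
    obtain x y t where xyt: "v = (x, y, t)" by (cases v) auto
    have "integral y" using int v xyt by (auto simp: compl_B_def)
    moreover have "integral (x + y)" using v xyt by (auto simp: compl_B_def)
    ultimately have "integral x" using integral_closed(3)[of "x + y" y] by simp
    then show "v \<in> trivial" using \<open>integral y\<close> v xyt by (auto simp: trivial_def compl_B_def)
  qed
qed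

text \<open>
  Cut \<open>y\<close> off below \<open>n\<close> and correct the sum of the coefficients at place \<open>n\<close>, where the
  bound on the order is weakest among the places in question.
\<close>

lemma dyadic_split:
  assumes "dyadic y"
  obtains y' where "dyadic y'" "poly y' 1 = 0" "\<And>k. k > n \<Longrightarrow> coeff y' k = 0"
    "\<And>k. k < n \<Longrightarrow> coeff y' k = coeff y k"
proof -
  define c where "c = (\<Sum>k<n. coeff y k)"
  define y' where "y' = (\<Sum>k<n. monom (coeff y k) k) - monom c n"
  have co: "coeff y' k = (if k < n then coeff y k else if k = n then - c else 0)" for k
    by (auto simp: y'_def coeff_sum sum.delta')
  have "2 ^ Suc n * c \<in> \<int>"
  proof -
    have "2 ^ Suc n * coeff y k \<in> \<int>" if "k < n" for k
    proof -
      have "(2 :: rat) ^ Suc n = 2 ^ (n - k) * 2 ^ Suc k" 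
        unfolding power_add[symmetric] using that by simp
      then have "2 ^ Suc n * coeff y k = 2 ^ (n - k) * (2 ^ Suc k * coeff y k)" by (simp only: mult.assoc)
      moreover have "2 ^ Suc k * coeff y k \<in> \<int>" using assms unfolding dyadic_def by blast
      ultimately show ?thesis by (metis Ints_mult Ints_numeral Ints_power)
    qed
    then show ?thesis unfolding c_def sum_distrib_left by (intro Ints_sum) simp
  qed
  then have "dyadic y'" using assms by (auto simp: dyadic_def co simp del: power_Suc)
  moreover have "poly y' 1 = 0" by (simp add: y'_def c_def poly_sum poly_monom)
  ultimately show ?thesis using that co by simp
qed

lemma base_compl_sum:
  "v \<in> leg_C \<Longrightarrow> \<exists>a\<in>base n. \<exists>c\<in>compl_C n. v = addM ambient a c"
  "v \<in> leg_B \<Longrightarrow> \<exists>a\<in>base n. \<exists>c\<in>compl_B n. v = addM ambient a c"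
proof -
  obtain x y t where v: "v = (x, y, t)" by (cases v) auto
  {
    assume *: "v \<in> leg_C"
    then have "dyadic y" by (simp add: v leg_C_def)
    then obtain y' where y': "dyadic y'" "poly y' 1 = 0" "\<And>k. k > n \<Longrightarrow> coeff y' k = 0"
      "\<And>k. k < n \<Longrightarrow> coeff y' k = coeff y k" using dyadic_split[of y n] by metis
    have "(x, y', t) \<in> base n" using * y' by (simp add: v leg_C_def base_def)
    moreover have "(0, y - y', 0) \<in> compl_C n"
      using * y' by (simp add: v leg_C_def compl_C_def integral_closed dyadic_closed)
    moreover have "v = addM ambient (x, y', t) (0, y - y', 0)" by (simp add: v)
    ultimately show "\<exists>a\<in>base n. \<exists>c\<in>compl_C n. v = addM ambient a c" by blast
  next
    assume *: "v \<in> leg_B"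
    then have dy: "dyadic x" "dyadic y" by (simp_all add: v leg_B_def)
    then obtain y' where y': "dyadic y'" "poly y' 1 = 0" "\<And>k. k > n \<Longrightarrow> coeff y' k = 0"
      "\<And>k. k < n \<Longrightarrow> coeff y' k = coeff y k" using dyadic_split[of y n] by metis
    have "(x + (y - y'), y', t) \<in> base n"
      using * dy y' by (simp add: v leg_B_def base_def dyadic_closed)
    moreover have "(- (y - y'), y - y', 0) \<in> compl_B n"
      using dy y' by (simp add: compl_B_def integral_closed dyadic_closed)
    moreover have "v = addM ambient (x + (y - y'), y', t) (- (y - y'), y - y', 0)" by (simp add: v)
    ultimately show "\<exists>a\<in>base n. \<exists>c\<in>compl_B n. v = addM ambient a c" by blast
  }
qed

lemma countable_triples: "countable (S :: triple set)"
proof -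
  have "countable (range Poly :: rat poly set)" by simp
  moreover have "range Poly = (UNIV :: rat poly set)" using Poly_coeffs by (metis surjI)
  ultimately have "countable (UNIV :: rat poly set)" by simp
  then have "countable ((UNIV :: rat poly set) \<times> (UNIV :: rat poly set) \<times> (UNIV :: rat set))"
    by (intro countable_SIGMA) auto
  then show ?thesis by (rule countable_subset[rotated]) auto
qed

text \<open>
  The element \<open>e = (0, 0, 1 / 2)\<close> does not lie in \<open>2\<^sup>\<omega>\<^sup>+\<^sup>1 B\<close>: divisibility by \<open>2\<^sup>k\<^sup>+\<^sup>1\<close> kills the
  \<open>k\<close>-th coefficients, and an element of \<open>B\<close> of the form \<open>(0, 0, t)\<close> satisfies \<open>2 t = 0\<close> modulo \<open>\<int>\<close>.
\<close>

lemma no_divisible_half: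
  assumes v: "v \<in> leg_B" and half: "addM ambient (scalM ambient 2 v) (negM ambient (0, 0, 1 / 2)) \<in> trivial"
    and div: "\<And>n. \<exists>w\<in>leg_B. addM ambient (scalM ambient (2 ^ n) w) (negM ambient v) \<in> trivial"
  shows False
proof -
  obtain x y t where xyt: "v = (x, y, t)" by (cases v) auto
  have "coeff x k \<in> \<int> \<and> coeff y k \<in> \<int>" for k
  proof -
    obtain x' y' t' where w: "dyadic x'" "dyadic y'"
      "addM ambient (scalM ambient (2 ^ Suc k) (x', y', t')) (negM ambient v) \<in> trivial"
      using div[of "Suc k"] by (auto simp: leg_B_def)
    have eq: "(of_int (2 ^ Suc k) :: rat) = 2 ^ Suc k" by simp
    have "2 ^ Suc k * coeff x' k - coeff x k \<in> \<int>" "2 ^ Suc k * coeff y' k - coeff y k \<in> \<int>"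
      using w(3) unfolding xyt ambient_simps trivial_def integral_def eq
      by (auto simp del: power_Suc dest: spec[of _ k])
    moreover have "2 ^ Suc k * coeff x' k \<in> \<int>" "2 ^ Suc k * coeff y' k \<in> \<int>"
      using w(1,2) unfolding dyadic_def by blast+
    ultimately have "2 ^ Suc k * coeff x' k - (2 ^ Suc k * coeff x' k - coeff x k) \<in> \<int>"
      "2 ^ Suc k * coeff y' k - (2 ^ Suc k * coeff y' k - coeff y k) \<in> \<int>"
      using Ints_diff by blast+
    then show ?thesis by simp
  qed
  then have "integral (x + y)" by (simp add: integral_def)
  then have "poly (x + y) 1 \<in> \<int>" by (rule integral_poly_1)
  moreover have "2 * t - poly (x + y) 1 \<in> \<int>" using v by (simp add: xyt leg_B_def)
  ultimately have "2 * t \<in> \<int>" using Ints_add[of "2 * t - poly (x + y) 1" "poly (x + y) 1"] by simp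
  moreover have "2 * t - 1 / 2 \<in> \<int>" using half by (simp add: xyt trivial_def)
  ultimately have "2 * t - (2 * t - 1 / 2) \<in> \<int>" by (rule Ints_diff)
  then have "(1 / 2 :: rat) \<in> \<int>" by simp
  then obtain k where "1 / 2 = (of_int k :: rat)" by (auto elim: Ints_cases)
  then have "of_int (2 * k) = (1 :: rat)" by simp
  then have "2 * k = 1" by (metis of_int_eq_1_iff)
  then show False by presburger
qed

section \<open>The failure of amalgamation\<close>

lemma strong_embedding_imp_hom:
  assumes "strong_embedding R prec f X Y"
  shows "mod_hom R f X Y" "inj_on f (univ X)"
proof -
  obtain E where E: "iso_struct R f X E" "substructure R E Y"
    using assms unfolding strong_embedding_def by blast
  show "inj_on f (univ X)" using E(1) by (simp add: iso_struct_def bij_betw_def)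
  have img: "f x \<in> univ E" if "x \<in> univ X" for x
    using E(1) that by (auto simp: iso_struct_def bij_betw_def)
  have "univ E \<subseteq> univ Y" using E(2) by (simp add: substructure_def)
  with img have "f ` univ X \<subseteq> univ Y" by blast
  then show "mod_hom R f X Y"
    using E img by (simp add: iso_struct_def substructure_def mod_hom_def)
qed

text \<open>
  In \<open>B\<close> and \<open>C\<close> the elements \<open>b\<^sub>n = c\<^sub>n + d\<^sub>n\<close> and \<open>c\<^sub>n\<close> satisfy \<open>b\<^sub>0 - 2\<^sup>n b\<^sub>n = c\<^sub>0 - 2\<^sup>n c\<^sub>n\<close>, and
  this element lies in \<open>A\<close>.  In any amalgam the difference of the images of \<open>b\<^sub>0\<close> and \<open>c\<^sub>0\<close> is
  therefore divisible by every power of 2, while its double is the image of \<open>2 b\<^sub>0 - 2 c\<^sub>0 = e\<close>.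
  So \<open>e\<close> acquires a divisible half, which it lacks in \<open>B\<close>.
\<close>

theorem no_amalgamation:
  fixes prec :: "(int, 'u) struct \<Rightarrow> (int, 'u) struct \<Rightarrow> bool"
  assumes inac: "inaccessible (UNIV :: 'u set)" and L: "prec \<in> L_class \<Z>"
    and weak: "\<And>A B. prec A B \<Longrightarrow> weak_pp_le \<Z> A B"
  shows "\<not> amalgamation_property \<Z> (R_Mod \<Z>) prec"
proof
  assume amalg: "amalgamation_property \<Z> (R_Mod \<Z>) prec"
  have Z: "ring \<Z>" by (rule int.ring_axioms)
  obtain \<iota> :: "triple \<Rightarrow> 'u" where \<iota>: "inj_on \<iota> (univ ambient)"
  proof -
    obtain on :: "nat \<Rightarrow> 'u" and \<omega> :: 'u
      where less: "\<And>m n. ord_less (on m) (on n) \<longleftrightarrow> m < n"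
      by (rule omega_exists[OF inac]) (rule that)
    have "inj on" using less by (metis injI linorder_neqE_nat less_irrefl)
    moreover obtain h :: "triple \<Rightarrow> nat" where "inj h"
      using countable_triples[of UNIV] by (auto simp: countable_def)
    ultimately have "inj (on \<circ> h)" by (rule inj_compose)
    then show ?thesis by (intro that) simp
  qed
  obtain q :: "triple \<Rightarrow> 'u" and W where W: "left_module \<Z> W" and q: "mod_hom \<Z> q ambient W"
    and ker: "\<And>x y. q x = q y \<longleftrightarrow> addM ambient x (negM ambient y) \<in> trivial"
    by (rule quotient_module_exists[OF Z left_module_ambient submodules(1) \<iota>], rule that)
       (assumption | simp only: ambient_simps(1) UNIV_I)+
  have q_simps: "\<And>u v. addM W (q u) (q v) = q (addM ambient u v)"
    "\<And>r u. scalM W r (q u) = q (scalM ambient r u)" "zeroM W = q (0, 0, 0)"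
    using q by (auto simp: mod_hom_def)
  define str where "str S = restrict_struct \<Z> (q ` S) W" for S
  have subW: "is_submodule \<Z> (q ` S) W" if "is_submodule \<Z> S ambient" for S
    by (rule is_submodule_image[OF left_module_ambient q that])
  have sub_base: "is_submodule \<Z> (\<Union>n. q ` base n) W"
  proof -
    have "is_submodule \<Z> (\<Union>n. base n) ambient"
    proof (rule is_submodule_ambientI)
      fix x y t x' y' t'
      assume "(x, y, t) \<in> (\<Union>n. base n)" "(x', y', t') \<in> (\<Union>n. base n)"
      then obtain m n where "(x, y, t) \<in> base m" "(x', y', t') \<in> base n" by blast
      then have "(x, y, t) \<in> base (max m n)" "(x', y', t') \<in> base (max m n)"
        using base_le(4)[of m "max m n"] base_le(4)[of n "max m n"] by auto
      then have "addM ambient (x, y, t) (x', y', t') \<in> base (max m n)"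
        using submodules(4)[of "max m n"] unfolding is_submodule_def by blast
      then show "(x + x', y + y', t + t') \<in> (\<Union>n. base n)" by auto
    next
      show "(0, 0, 0) \<in> (\<Union>n. base n)" using submodules(4)[of 0] by (auto simp: is_submodule_def)
    next
      fix r x y t
      assume "(x, y, t) \<in> (\<Union>n. base n)"
      then obtain n where "(x, y, t) \<in> base n" by blast
      then have "scalM ambient r (x, y, t) \<in> base n"
        using submodules(4)[of n] int_Zcarr unfolding is_submodule_def by blast
      then show "(smult (of_int r) x, smult (of_int r) y, of_int r * t) \<in> (\<Union>n. base n)" by auto
    qed
    then show ?thesis using subW[of "\<Union>n. base n"] by (simp add: image_UN)
  qed
  define A where "A = str (\<Union>n. base n)"
  define B where "B = str leg_B"
  define C where "C = str leg_C"
  have aec: "AEC \<Z> (R_Mod \<Z>) prec" and summand: "\<And>M N. summand_le \<Z> M N \<Longrightarrow> prec M N"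
    using L by (auto simp: L_class_def)
  have chain: "substructure \<Z> (str (base m)) (str (base n))" if "m < n" for m n
    unfolding str_def using that
    by (intro substructure_restrict_restrict subW submodules image_mono base_le) simp
  have unionA: "univ A = (\<Union>n. univ (str (base n)))" "\<And>n. substructure \<Z> (str (base n)) A"
    unfolding A_def str_def image_UN
    by (auto intro!: substructure_restrict_restrict subW submodules sub_base)
  have small: "small (q ` S)" for S
    by (intro countable_imp_small[OF inac] countable_image countable_triples)
  have "prec (str (base n)) B" for n
    unfolding B_def str_def
    by (intro summand quotient_summand[where N=trivial and E="compl_B n" and q=q, OF Z left_module_ambient W q]
        ker submodules base_le compl_le base_compl_disjoint base_compl_sum small)
  then have AB: "prec A B"
    by (rule AEC_countable_chain_union[where S="\<lambda>n. str (base n)", OF inac aec _ chain unionA])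
  have "prec (str (base n)) C" for n
    unfolding C_def str_def
    by (intro summand quotient_summand[where N=trivial and E="compl_C n" and q=q, OF Z left_module_ambient W q]
        ker submodules base_le compl_le base_compl_disjoint base_compl_sum small)
  then have AC: "prec A C"
    by (rule AEC_countable_chain_union[where S="\<lambda>n. str (base n)", OF inac aec _ chain unionA])
  have inK: "X \<in> R_Mod \<Z> \<and> Y \<in> R_Mod \<Z>" if "prec X Y" for X Y
    using weak[OF that] by (simp add: weak_pp_le_def formula_le_def submodule_le_def)
  have "\<exists>D\<in>R_Mod \<Z>. \<exists>f g. strong_embedding \<Z> prec f B D \<and> strong_embedding \<Z> prec g C D \<and>
      (\<forall>x\<in>univ A. f x = g x)"
    using amalg[unfolded amalgamation_property_def, rule_format, of A B C] inK[OF AB] inK[OF AC] AB AC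
    by simp
  then obtain D f g where D: "D \<in> R_Mod \<Z>" and f: "strong_embedding \<Z> prec f B D"
    and g: "strong_embedding \<Z> prec g C D" and agree: "\<And>x. x \<in> univ A \<Longrightarrow> f x = g x"
    by (elim bexE exE conjE) (rule that, assumption, assumption, assumption, drule bspec)
  note fh = strong_embedding_imp_hom[OF f] and gh = strong_embedding_imp_hom[OF g]
  interpret D: rmodule \<Z> D using D by unfold_locales (simp add: R_Mod_def)
  have univs: "univ A = (\<Union>n. q ` base n)" "univ B = q ` leg_B" "univ C = q ` leg_C"
    by (auto simp: A_def B_def C_def str_def)
  have opsB: "\<And>u v. u \<in> leg_B \<Longrightarrow> v \<in> leg_B \<Longrightarrow> addM B (q u) (q v) = q (addM ambient u v)"
    "\<And>r u. u \<in> leg_B \<Longrightarrow> scalM B r (q u) = q (scalM ambient r u)"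
    by (auto simp: B_def str_def restrict_struct_def q_simps)
  have opsC: "\<And>u v. u \<in> leg_C \<Longrightarrow> v \<in> leg_C \<Longrightarrow> addM C (q u) (q v) = q (addM ambient u v)"
    "\<And>r u. u \<in> leg_C \<Longrightarrow> scalM C r (q u) = q (scalM ambient r u)"
    by (auto simp: C_def str_def restrict_struct_def q_simps)
  have fadd: "f (q (addM ambient u v)) = addM D (f (q u)) (f (q v))" if "u \<in> leg_B" "v \<in> leg_B" for u v
    using fh(1) that opsB by (auto simp: mod_hom_def univs)
  have fscal: "f (q (scalM ambient r u)) = scalM D r (f (q u))" if "u \<in> leg_B" for r u
    using fh(1) that opsB by (auto simp: mod_hom_def univs)
  have gadd: "g (q (addM ambient u v)) = addM D (g (q u)) (g (q v))" if "u \<in> leg_C" "v \<in> leg_C" for u v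
    using gh(1) that opsC by (auto simp: mod_hom_def univs)
  have gscal: "g (q (scalM ambient r u)) = scalM D r (g (q u))" if "u \<in> leg_C" for r u
    using gh(1) that opsC by (auto simp: mod_hom_def univs)
  have fD: "f (q u) \<in> univ D" if "u \<in> leg_B" for u
    using fh(1) that by (auto simp: mod_hom_def univs)
  have gD: "g (q u) \<in> univ D" if "u \<in> leg_C" for u
    using gh(1) that by (auto simp: mod_hom_def univs)
  \<comment> \<open>The common value \<open>b\<^sub>0 - 2\<^sup>n b\<^sub>n = c\<^sub>0 - 2\<^sup>n c\<^sub>n\<close>.\<close>
  define a where "a n = (0 :: rat poly, monom (1 / 2 :: rat) 0 - monom (1 / 2) n, 0 :: rat)" for n
  define b where "b n = (0 :: rat poly, monom (1 / 2 ^ Suc n :: rat) n, 1 / 2 ^ (n + 2) :: rat)" for n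
  define c where "c n = (0 :: rat poly, monom (1 / 2 ^ Suc n :: rat) n, 0 :: rat)" for n
  define e where "e = (0 :: rat poly, 0 :: rat poly, 1 / 2 :: rat)"
  have dyadic_monom: "dyadic (monom (1 / 2 ^ Suc n) n)" for n by (simp add: dyadic_def)
  have bB: "b n \<in> leg_B" for n
    using dyadic_monom[of n] by (simp add: b_def leg_B_def dyadic_closed poly_monom)
  have cC: "c n \<in> leg_C" for n
    using dyadic_monom[of n] by (simp add: c_def leg_C_def dyadic_closed)
  have a_base: "a n \<in> base n" for n
  proof -
    have "dyadic (monom (1 / 2) n :: rat poly)" by (simp add: dyadic_def)
    moreover have "dyadic (monom (1 / 2) 0 :: rat poly)" by (simp add: dyadic_def)
    ultimately show ?thesis by (simp add: a_def base_def dyadic_closed poly_monom)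
  qed
  have aB: "a n \<in> leg_B" and aC: "a n \<in> leg_C" for n using a_base[of n] base_le by blast+
  have fa_ga: "f (q (a n)) = g (q (a n))" for n using a_base[of n] by (intro agree) (auto simp: univs)
  have b_rec: "addM ambient (a n) (scalM ambient (2 ^ n) (b n)) = b 0" for n
    by (simp add: a_def b_def smult_monom power_add)
  have c_rec: "addM ambient (a n) (scalM ambient (2 ^ n) (c n)) = c 0" for n
    by (simp add: a_def c_def smult_monom)
  have eB: "e \<in> leg_B" by (simp add: e_def leg_B_def dyadic_closed)
  have scal_mem: "scalM ambient r u \<in> leg_B" if "u \<in> leg_B" for r u
    using that submodules(3) by (simp add: is_submodule_def)
  have scal_mem': "scalM ambient r u \<in> leg_C" if "u \<in> leg_C" for r u
    using that submodules(2) by (simp add: is_submodule_def)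
  have triv: "(0, monom 1 0, 0) \<in> trivial" by (simp add: trivial_def integral_def)
  have "q (scalM ambient 2 (b 0)) = q e"
    unfolding ker using triv by (simp add: b_def e_def smult_monom)
  then have fb: "scalM D 2 (f (q (b 0))) = f (q e)" using fscal[OF bB, of 2] by metis
  have "q (scalM ambient 2 (c 0)) = q (0, 0, 0)"
    unfolding ker using triv by (simp add: c_def smult_monom)
  moreover have "g (q (0, 0, 0)) = zeroM D"
    using gh(1) by (simp add: mod_hom_def C_def str_def restrict_struct_def q_simps)
  ultimately have gc: "scalM D 2 (g (q (c 0))) = zeroM D"
    using gscal[OF cC[of 0], of 2] by simp
  \<comment> \<open>The difference of the images of \<open>b\<^sub>0\<close> and \<open>c\<^sub>0\<close>, a half of \<open>e\<close> in \<open>2\<^sup>\<omega> D\<close>.\<close>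
  define y where "y = addM D (f (q (b 0))) (negM D (g (q (c 0))))"
  have y: "y \<in> univ D" using fD[OF bB] gD[OF cC] by (simp add: y_def)
  have "scalM D 2 y = f (q e)"
    using fD[OF bB[of 0]] gD[OF cC[of 0]] fD[OF eB] fb gc
    by (simp add: y_def D.scal_add D.scal_neg)
  moreover have "\<exists>z\<in>univ D. scalM D (2 ^ n) z = y" for n
  proof -
    define fb where "fb = f (q (b n))"
    define gc where "gc = g (q (c n))"
    define fa where "fa = f (q (a n))"
    have cl: "fa \<in> univ D" "fb \<in> univ D" "gc \<in> univ D"
      using fD[OF aB] fD[OF bB] gD[OF cC] by (auto simp: fa_def fb_def gc_def)
    have scl: "scalM D (2 ^ n) fb \<in> univ D" "scalM D (2 ^ n) gc \<in> univ D" using cl by auto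
    have 1: "f (q (b 0)) = addM D fa (scalM D (2 ^ n) fb)"
      using fadd[OF aB scal_mem[OF bB], of n "2 ^ n" n] fscal[OF bB, of "2 ^ n" n] b_rec[of n]
      by (simp add: fa_def fb_def)
    have 2: "g (q (c 0)) = addM D fa (scalM D (2 ^ n) gc)"
      using gadd[OF aC scal_mem'[OF cC], of n "2 ^ n" n] gscal[OF cC, of "2 ^ n" n] c_rec[of n] fa_ga
      by (simp add: fa_def gc_def)
    have "y = addM D (addM D fa (scalM D (2 ^ n) fb)) (negM D (addM D fa (scalM D (2 ^ n) gc)))"
      by (simp only: y_def 1 2)
    also have "\<dots> = addM D (scalM D (2 ^ n) fb) (negM D (scalM D (2 ^ n) gc))"
      using cl(1) scl by (simp add: D.neg_add D.add_ac)
    also have "\<dots> = scalM D (2 ^ n) (addM D fb (negM D gc))"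
      using cl by (simp add: D.scal_add D.scal_neg)
    finally show ?thesis using cl by (intro bexI[of _ "addM D fb (negM D gc)"]) auto
  qed
  ultimately have half_D: "\<exists>y\<in>univ D. scalM D 2 y = f (q e) \<and> (\<forall>n. \<exists>z\<in>univ D. scalM D (2 ^ n) z = y)"
    using y by blast
  \<comment> \<open>Weak infinitary purity of the image \<open>E\<close> of \<open>B\<close> brings a divisible half of \<open>e\<close> back to \<open>B\<close>.\<close>
  obtain E where E: "iso_struct \<Z> f B E" "substructure \<Z> E D" "prec E D"
    using f unfolding strong_embedding_def by blast
  have uE: "univ E = f ` q ` leg_B"
    using E(1) by (simp add: iso_struct_def bij_betw_def univs)
  have modE: "left_module \<Z> E" using inK[OF E(3)] by (simp add: R_Mod_def)
  obtain \<phi> :: "(int, 'u) fm" where \<phi>: "\<phi> \<in> Lambda_wpp \<Z>"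
    "\<And>(M :: (int, 'u) struct) u. left_module \<Z> M \<Longrightarrow> u \<in> univ M \<Longrightarrow> sat \<phi> M (\<lambda>_. u) \<longleftrightarrow>
       (\<exists>y\<in>univ M. scalM M 2 y = u \<and> (\<forall>n::nat. \<exists>z\<in>univ M. scalM M (2 ^ n) z = y))"
    by (rule divisible_half_formula[OF inac], rule that)
  have "sat \<phi> D (\<lambda>_. f (q e))"
    using \<phi>(2)[OF D.left_module fD[OF eB]] half_D by blast
  moreover have feE: "f (q e) \<in> univ E" using eB uE by blast
  moreover have "\<forall>\<phi>\<in>Lambda_wpp \<Z>. \<forall>a. range a \<subseteq> univ E \<longrightarrow> sat \<phi> E a = sat \<phi> D a"
    using weak[OF E(3)] unfolding weak_pp_le_def formula_le_def by blast
  ultimately have "sat \<phi> E (\<lambda>_. f (q e))" using \<phi>(1) by (simp add: image_subset_iff)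
  then obtain y where y: "y \<in> univ E" "scalM E 2 y = f (q e)"
    "\<And>n. \<exists>z\<in>univ E. scalM E (2 ^ n) z = y"
    using \<phi>(2)[OF modE feE] by blast
  obtain v where v: "v \<in> leg_B" "y = f (q v)" using y(1) uE by blast
  have scalE: "scalM E r (f (q u)) = f (q (scalM ambient r u))" if "u \<in> leg_B" for r u
  proof -
    have "f (scalM B r (q u)) = scalM E r (f (q u))"
      using E(1) that by (simp add: iso_struct_def univs)
    then show ?thesis using opsB(2)[OF that] by simp
  qed
  have f_eq: "q u = q w" if "f (q u) = f (q w)" "u \<in> leg_B" "w \<in> leg_B" for u w
    using fh(2) that by (auto simp: inj_on_def univs)
  show False
  proof (rule no_divisible_half[OF v(1)])
    have "q (scalM ambient 2 v) = q e"
      by (rule f_eq) (use y(2) v scalE scal_mem eB in auto)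
    then show "addM ambient (scalM ambient 2 v) (negM ambient (0, 0, 1 / 2)) \<in> trivial"
      unfolding ker e_def .
    show "\<exists>w\<in>leg_B. addM ambient (scalM ambient (2 ^ n) w) (negM ambient v) \<in> trivial" for n
    proof -
      obtain z where z: "z \<in> univ E" "scalM E (2 ^ n) z = y" using y(3) by blast
      then obtain w where w: "w \<in> leg_B" "z = f (q w)" using uE by blast
      have "q (scalM ambient (2 ^ n) w) = q v"
        by (rule f_eq) (use z(2) v w scalE scal_mem in auto)
      then show ?thesis unfolding ker using w(1) by blast
    qed
  qed
qed

theorem theorem1p2:
  assumes "inaccessible (UNIV :: 'u set)"
  shows "(\<forall>(R :: 'r ring) (prec :: ('r, 'u) struct \<Rightarrow> ('r, 'u) struct \<Rightarrow> bool).
            ring R \<and> prec \<in> L1_class R \<and> pleasant R prec \<longrightarrow>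
            amalgamation_property R (R_Mod R) prec) \<and>
         (\<forall>prec :: (int, 'u) struct \<Rightarrow> (int, 'u) struct \<Rightarrow> bool.
            prec \<in> L2_class \<Z> \<and> positive_syntactic \<Z> prec \<and>
            (\<forall>A B. prec A B \<longrightarrow> weak_pp_le \<Z> A B) \<longrightarrow>
            \<not> amalgamation_property \<Z> (R_Mod \<Z>) prec)"
proof (intro conjI allI impI; elim conjE)
  fix R :: "'r ring" and prec :: "('r, 'u) struct \<Rightarrow> ('r, 'u) struct \<Rightarrow> bool"
  assume "ring R" "pleasant R prec"
  then show "amalgamation_property R (R_Mod R) prec" by (rule pleasant_amalgamation[OF assms])
next
  fix prec :: "(int, 'u) struct \<Rightarrow> (int, 'u) struct \<Rightarrow> bool"
  assume "prec \<in> L2_class \<Z>" and weak: "\<forall>A B. prec A B \<longrightarrow> weak_pp_le \<Z> A B"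
  then have "prec \<in> L_class \<Z>" by (simp add: L2_class_def)
  then show "\<not> amalgamation_property \<Z> (R_Mod \<Z>) prec"
    using weak by (intro no_amalgamation[OF assms]) blast+
qed

end
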